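(* Let $\mathfrak{g}$ be the $8$-dimensional real nilpotent Lie algebra \[(0,0,0,0,12+34,14-23,-24+35+16,-13+26+45).\] Then the following four metrics on $\mathfrak{g}$ (upper signs, respectively lower signs, being taken simultaneously within each line) are Einstein with scalar curvature $\frac{56}{15}$: \begin{enumerate} \item[(i)] $e^1\otimes e^1+e^2\otimes e^2\pm(e^3\otimes e^3+e^4\otimes e^4)-\tfrac73 e^5\otimes e^5\mp\tfrac73 e^6\otimes e^6\pm\tfrac{98}{15}(e^7\otimes e^7+e^8\otimes e^8)$; \item[(ii)] $-e^1\odot e^2\mp e^3\odot e^4+\tfrac73 e^5\otimes e^5\pm\tfrac73 e^6\otimes e^6\pm\tfrac{98}{15}e^7\odot e^8$. \end{enumerate} Moreover, these metrics are not locally symmetric and their holonomy is generic, namely: $\mathrm{SO}_+(6,2)$ and $\mathrm{SO}_+(3,5)$ for (i) with upper and lower signs respectively, and $\mathrm{SO}_+(5,3)$ and $\mathrm{SO}_+(4,4)$ for (ii) with upper and lower signs respectively.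
   Context: Notation for Lie algebras: the $n$-tuple denotes the real Lie algebra $\mathfrak{g}$ for which there is a basis $e^1,\dots,e^n$ of $\mathfrak{g}^*$ such that $de^k$ is the $k$-th entry, where $ij$ stands for $e^{ij}=e^i\wedge e^j$ and $d\colon\mathfrak{g}^*\to\Lambda^2\mathfrak{g}^*$ is the Chevalley–Eilenberg differential $d\alpha(x,y)=-\alpha([x,y])$. The $e^i$ in the claim are this basis. The symmetric product is $e^i\odot e^j=e^i\otimes e^j+e^j\otimes e^i$. A metric on a real Lie algebra $\mathfrak{g}$ is a non-degenerate symmetric bilinear form on $\mathfrak{g}$ of arbitrary signature; it is identified with the left-invariant pseudoriemannian metric it defines on the connected, simply connected Lie group with Lie algebra $\mathfrak{g}$. Its Ricci operator $\operatorname{ric}\colon\mathfrak{g}\to\mathfrak{g}$, scalar curvature $s=\operatorname{tr}\operatorname{ric}$, local symmetry (parallel curvature tensor) and holonomy are those of that left-invariant metric. The metric is Einstein if $\operatorname{ric}=\lambda\,\mathrm{Id}$ for some $\lambda\in\mathbb{R}$. $\mathrm{SO}_+(p,q)$ denotes the identity component of $\mathrm{SO}(p,q)$, with $p$ the number of positive and $q$ the number of negative directions. *)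

theory Defs
  imports "HOL-Analysis.Analysis"
begin

section \<open>Left-invariant metrics\<close>

text \<open>
  A Lie algebra structure on \<open>real ^ 'n\<close> is given by its bracket \<open>b\<close>.
  Left-invariant tensor fields on a Lie group are identified with tensors on its Lie algebra.
\<close>

definition pseudo_metric :: "(real ^ 'n \<Rightarrow> real ^ 'n \<Rightarrow> real) \<Rightarrow> bool" where
  "pseudo_metric g \<longleftrightarrow> bilinear g \<and> (\<forall>x y. g x y = g y x) \<and> (\<forall>x. (\<forall>y. g x y = 0) \<longrightarrow> x = 0)"

text \<open>
  The Levi-Civita connection on left-invariant vector fields. The covariant derivative of a
  left-invariant field along a left-invariant field is left-invariant, and the metric coefficients
  \<open>g y z\<close> are constant, so metric compatibility contains no derivative of \<open>g y z\<close>.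
\<close>

definition levi_civita ::
  "(real ^ 'n \<Rightarrow> real ^ 'n \<Rightarrow> real ^ 'n) \<Rightarrow> (real ^ 'n \<Rightarrow> real ^ 'n \<Rightarrow> real) \<Rightarrow>
    real ^ 'n \<Rightarrow> real ^ 'n \<Rightarrow> real ^ 'n" where
  "levi_civita b g = (THE D. bilinear D \<and>
     (\<forall>x y. D x y - D y x = b x y) \<and>
     (\<forall>x y z. g (D x y) z + g y (D x z) = 0))"

definition curvature ::
  "(real ^ 'n \<Rightarrow> real ^ 'n \<Rightarrow> real ^ 'n) \<Rightarrow> (real ^ 'n \<Rightarrow> real ^ 'n \<Rightarrow> real) \<Rightarrow>
    real ^ 'n \<Rightarrow> real ^ 'n \<Rightarrow> real ^ 'n \<Rightarrow> real ^ 'n" where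
  "curvature b g x y z = (let D = levi_civita b g in
     D x (D y z) - D y (D x z) - D (b x y) z)"

definition ricci_tensor ::
  "(real ^ 'n \<Rightarrow> real ^ 'n \<Rightarrow> real ^ 'n) \<Rightarrow> (real ^ 'n \<Rightarrow> real ^ 'n \<Rightarrow> real) \<Rightarrow>
    real ^ 'n \<Rightarrow> real ^ 'n \<Rightarrow> real" where
  "ricci_tensor b g y z = trace (matrix (\<lambda>x. curvature b g x y z))"

definition ricci_operator ::
  "(real ^ 'n \<Rightarrow> real ^ 'n \<Rightarrow> real ^ 'n) \<Rightarrow> (real ^ 'n \<Rightarrow> real ^ 'n \<Rightarrow> real) \<Rightarrow>
    real ^ 'n \<Rightarrow> real ^ 'n" where
  "ricci_operator b g y = (THE v. \<forall>z. g v z = ricci_tensor b g y z)"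

definition scalar_curvature ::
  "(real ^ 'n \<Rightarrow> real ^ 'n \<Rightarrow> real ^ 'n) \<Rightarrow> (real ^ 'n \<Rightarrow> real ^ 'n \<Rightarrow> real) \<Rightarrow> real" where
  "scalar_curvature b g = trace (matrix (ricci_operator b g))"

definition einstein ::
  "(real ^ 'n \<Rightarrow> real ^ 'n \<Rightarrow> real ^ 'n) \<Rightarrow> (real ^ 'n \<Rightarrow> real ^ 'n \<Rightarrow> real) \<Rightarrow> bool" where
  "einstein b g \<longleftrightarrow> (\<exists>l. \<forall>x. ricci_operator b g x = l *\<^sub>R x)"

definition nabla_curvature ::
  "(real ^ 'n \<Rightarrow> real ^ 'n \<Rightarrow> real ^ 'n) \<Rightarrow> (real ^ 'n \<Rightarrow> real ^ 'n \<Rightarrow> real) \<Rightarrow>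
    real ^ 'n \<Rightarrow> real ^ 'n \<Rightarrow> real ^ 'n \<Rightarrow> real ^ 'n \<Rightarrow> real ^ 'n" where
  "nabla_curvature b g w x y z = (let D = levi_civita b g; R = curvature b g in
     D w (R x y z) - R (D w x) y z - R x (D w y) z - R x y (D w z))"

definition locally_symmetric ::
  "(real ^ 'n \<Rightarrow> real ^ 'n \<Rightarrow> real ^ 'n) \<Rightarrow> (real ^ 'n \<Rightarrow> real ^ 'n \<Rightarrow> real) \<Rightarrow> bool" where
  "locally_symmetric b g \<longleftrightarrow> (\<forall>w x y z. nabla_curvature b g w x y z = 0)"

section \<open>Holonomy\<close>

text \<open>
  The connected, simply connected Lie group of a nilpotent Lie algebra of step at most three:
  the exponential map is a diffeomorphism, and in exponential coordinates the product is given by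
  the Baker-Campbell-Hausdorff formula, with identity \<open>0\<close>.
\<close>

definition bch :: "('a \<Rightarrow> 'a \<Rightarrow> 'a) \<Rightarrow> 'a \<Rightarrow> 'a \<Rightarrow> 'a::real_vector" where
  "bch b x y = x + y + (1/2) *\<^sub>R b x y + (1/12) *\<^sub>R (b x (b x y) + b y (b y x))"

definition left_translation_deriv ::
  "(real ^ 'n \<Rightarrow> real ^ 'n \<Rightarrow> real ^ 'n) \<Rightarrow> real ^ 'n \<Rightarrow> real ^ 'n \<Rightarrow> real ^ 'n" where
  "left_translation_deriv b p = frechet_derivative (bch b p) (at 0)"

text \<open>
  Matrix of the parallel transport along a continuously differentiable curve \<open>c\<close> in the group. All
  tangent spaces are identified with the Lie algebra by left translation: \<open>u t\<close> and \<open>V t\<close>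
  represent the velocity of \<open>c\<close> and a vector field along \<open>c\<close>, whose covariant derivative along \<open>c\<close>
  is then represented by \<open>V' + levi_civita b g u V\<close>.
\<close>

definition transport_along ::
  "(real ^ 'n \<Rightarrow> real ^ 'n \<Rightarrow> real ^ 'n) \<Rightarrow> (real ^ 'n \<Rightarrow> real ^ 'n \<Rightarrow> real) \<Rightarrow>
    (real \<Rightarrow> real ^ 'n) \<Rightarrow> real ^ 'n ^ 'n \<Rightarrow> bool" where
  "transport_along b g c A \<longleftrightarrow>
     (\<exists>u. continuous_on {0..1} u \<and>
       (\<forall>t\<in>{0..1}. (c has_vector_derivative left_translation_deriv b (c t) (u t)) (at t within {0..1})) \<and>
       (\<forall>v. \<exists>V. V 0 = v \<and> V 1 = A *v v \<and>
         (\<forall>t\<in>{0..1}. (V has_vector_derivative - levi_civita b g (u t) (V t)) (at t within {0..1}))))"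

text \<open>Parallel transports along piecewise continuously differentiable curves from \<open>p\<close> to \<open>q\<close>.\<close>

inductive transport ::
  "(real ^ 'n \<Rightarrow> real ^ 'n \<Rightarrow> real ^ 'n) \<Rightarrow> (real ^ 'n \<Rightarrow> real ^ 'n \<Rightarrow> real) \<Rightarrow>
    real ^ 'n \<Rightarrow> real ^ 'n \<Rightarrow> real ^ 'n ^ 'n \<Rightarrow> bool"
  for b g where
  refl: "transport b g p p (mat 1)"
| step: "transport b g p q A \<Longrightarrow> transport_along b g c B \<Longrightarrow> c 0 = q \<Longrightarrow> c 1 = r \<Longrightarrow>
    transport b g p r (B ** A)"

definition holonomy_group ::
  "(real ^ 'n \<Rightarrow> real ^ 'n \<Rightarrow> real ^ 'n) \<Rightarrow> (real ^ 'n \<Rightarrow> real ^ 'n \<Rightarrow> real) \<Rightarrow>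
    (real ^ 'n ^ 'n) set" where
  "holonomy_group b g = {A. transport b g 0 0 A}"

text \<open>
  Coordinates are indexed by the numeral type 8, i.e. integers modulo 8; the indices
  \<open>1, \<dots>, 8\<close> run through all its elements, with \<open>8 = 0\<close>. The matrix below has
  \<open>p\<close> entries 1 followed by \<open>q\<close> entries -1 on the diagonal.
\<close>

definition diag_pq :: "nat \<Rightarrow> nat \<Rightarrow> real ^ 8 ^ 8" where
  "diag_pq p q = (\<chi> i j. if i \<noteq> j then 0
     else if i \<in> of_nat ` {1..p} then 1
     else if i \<in> of_nat ` {p+1..p+q} then -1 else 0)"

definition SO :: "nat \<Rightarrow> nat \<Rightarrow> (real ^ 8 ^ 8) set" where
  "SO p q = {A. transpose A ** diag_pq p q ** A = diag_pq p q \<and> det A = 1}"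

definition SO_plus :: "nat \<Rightarrow> nat \<Rightarrow> (real ^ 8 ^ 8) set" where
  "SO_plus p q = connected_component_set (SO p q) (mat 1)"

text \<open>The holonomy group is \<open>SO_plus p q\<close> in an orthonormal frame, the columns of \<open>F\<close>.\<close>

definition holonomy_is_SO_plus ::
  "(real ^ 8 \<Rightarrow> real ^ 8 \<Rightarrow> real ^ 8) \<Rightarrow> (real ^ 8 \<Rightarrow> real ^ 8 \<Rightarrow> real) \<Rightarrow> nat \<Rightarrow> nat \<Rightarrow> bool" where
  "holonomy_is_SO_plus b g p q \<longleftrightarrow>
     (\<exists>F. invertible F \<and>
       (\<forall>x y. g (F *v x) (F *v y) = x \<bullet> (diag_pq p q *v y)) \<and>
       holonomy_group b g = {F ** A ** matrix_inv F | A. A \<in> SO_plus p q})"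

section \<open>The Lie algebra and the metrics\<close>

definition wedge :: "8 \<Rightarrow> 8 \<Rightarrow> real ^ 8 \<Rightarrow> real ^ 8 \<Rightarrow> real" where
  "wedge i j x y = x $ i * y $ j - x $ j * y $ i"

text \<open>
  The Lie algebra \<open>(0,0,0,0,12+34,14-23,-24+35+16,-13+26+45)\<close>. The \<open>k\<close>-th entry is \<open>de^k\<close>, and
  \<open>de^k(x,y) = -e^k([x,y])\<close>.
\<close>

definition n8 :: "real ^ 8 \<Rightarrow> real ^ 8 \<Rightarrow> real ^ 8" where
  "n8 x y = - vector [0, 0, 0, 0,
     wedge 1 2 x y + wedge 3 4 x y,
     wedge 1 4 x y - wedge 2 3 x y,
     - wedge 2 4 x y + wedge 3 5 x y + wedge 1 6 x y,
     - wedge 1 3 x y + wedge 2 6 x y + wedge 4 5 x y]"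

definition tens :: "8 \<Rightarrow> 8 \<Rightarrow> real ^ 8 \<Rightarrow> real ^ 8 \<Rightarrow> real" where
  "tens i j x y = x $ i * y $ j"

definition odot :: "8 \<Rightarrow> 8 \<Rightarrow> real ^ 8 \<Rightarrow> real ^ 8 \<Rightarrow> real" where
  "odot i j x y = tens i j x y + tens j i x y"

text \<open>The argument \<open>s\<close> is \<open>1\<close> for the upper signs and \<open>-1\<close> for the lower signs.\<close>

definition metric_i :: "real \<Rightarrow> real ^ 8 \<Rightarrow> real ^ 8 \<Rightarrow> real" where
  "metric_i s x y = tens 1 1 x y + tens 2 2 x y + s * (tens 3 3 x y + tens 4 4 x y)
     - 7/3 * tens 5 5 x y - s * (7/3) * tens 6 6 x y
     + s * (98/15) * (tens 7 7 x y + tens 8 8 x y)"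

definition metric_ii :: "real \<Rightarrow> real ^ 8 \<Rightarrow> real ^ 8 \<Rightarrow> real" where
  "metric_ii s x y = - odot 1 2 x y - s * odot 3 4 x y
     + 7/3 * tens 5 5 x y + s * (7/3) * tens 6 6 x y
     + s * (98/15) * odot 7 8 x y"

subsection \<open>Consistency of the definitions\<close>

lemma ex8: "(k::8) = 1 \<or> k = 2 \<or> k = 3 \<or> k = 4 \<or> k = 5 \<or> k = 6 \<or> k = 7 \<or> k = 8"
proof (induct k)
  case (of_int z)
  from of_int have "z < 8" by simp
  with \<open>0 \<le> z\<close> have
    "z = 0 \<or> z = 1 \<or> z = 2 \<or> z = 3 \<or> z = 4 \<or> z = 5 \<or> z = 6 \<or> z = 7" by presburger
  then show ?case by auto
qed

lemma vec8_eqI: "x$1 = y$1 \<Longrightarrow> x$2 = y$2 \<Longrightarrow> x$3 = y$3 \<Longrightarrow> x$4 = y$4 \<Longrightarrow>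
    x$5 = y$5 \<Longrightarrow> x$6 = y$6 \<Longrightarrow> x$7 = y$7 \<Longrightarrow> x$8 = y$8 \<Longrightarrow> x = y" for x y :: "'a ^ 8"
  unfolding vec_eq_iff
proof
  fix i :: 8
  assume "x$1 = y$1" "x$2 = y$2" "x$3 = y$3" "x$4 = y$4" "x$5 = y$5" "x$6 = y$6" "x$7 = y$7" "x$8 = y$8"
  with ex8[of i] show "x$i = y$i" by (elim disjE) (simp_all only:)
qed

lemma n8_nth:
  "n8 x y $ 1 = 0" "n8 x y $ 2 = 0" "n8 x y $ 3 = 0" "n8 x y $ 4 = 0"
  "n8 x y $ 5 = - (wedge 1 2 x y + wedge 3 4 x y)"
  "n8 x y $ 6 = - (wedge 1 4 x y - wedge 2 3 x y)"
  "n8 x y $ 7 = - (- wedge 2 4 x y + wedge 3 5 x y + wedge 1 6 x y)"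
  "n8 x y $ 8 = - (- wedge 1 3 x y + wedge 2 6 x y + wedge 4 5 x y)"
  by (simp_all add: n8_def vector_def)

lemma n8_lie_algebra:
  shows "bilinear n8" "n8 x x = 0"
    and "n8 x (n8 y z) + n8 y (n8 z x) + n8 z (n8 x y) = 0"
proof -
  show "bilinear n8"
    unfolding bilinear_def
    by (auto intro!: linearI vec8_eqI simp: n8_nth wedge_def algebra_simps)
  show "n8 x x = 0"
    by (rule vec8_eqI) (simp_all add: n8_nth wedge_def)
  show "n8 x (n8 y z) + n8 y (n8 z x) + n8 z (n8 x y) = 0"
    by (rule vec8_eqI) (simp_all add: n8_nth wedge_def, simp_all add: algebra_simps)
qed

lemma n8_nilpotent: "n8 w (n8 x (n8 y z)) = 0"
  by (rule vec8_eqI) (simp_all add: n8_nth wedge_def)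

lemma bch_n8_group:
  shows "bch n8 0 x = x" "bch n8 x 0 = x" "bch n8 (- x) x = 0"
    and "bch n8 (bch n8 x y) z = bch n8 x (bch n8 y z)"
proof -
  show "bch n8 0 x = x" "bch n8 x 0 = x" "bch n8 (- x) x = 0"
    by (rule vec8_eqI; simp add: bch_def n8_nth wedge_def)+
  show "bch n8 (bch n8 x y) z = bch n8 x (bch n8 y z)"
    by (rule vec8_eqI; simp add: bch_def n8_nth wedge_def; simp add: field_simps)
qed

end

theory Submission
  imports Defs
begin

text \<open>
  Parallel transport along the exponential of \<open>x\<close> is the matrix exponential of \<open>- D x\<close>, where \<open>D\<close>
  is the Levi-Civita connection. Closing up a conjugate of a one-parameter group gives loops whose
  holonomies are smooth curves through the identity, and differentiating them twice shows that every
  curvature endomorphism is tangent to the holonomy group. For these four metrics the curvature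
  operator on bivectors is invertible (a system of 28 linear equations), so the tangent space is the
  whole of \<open>so(p,q)\<close>. The open mapping theorem for continuous maps differentiable at one point then
  yields a neighbourhood of the identity of \<open>SO(p,q)\<close> inside the holonomy group, hence the whole
  identity component. The converse inclusion holds because parallel transport is an isometry
  connected to the identity.
\<close>

text \<open>The holonomy group is not known to be closed, so the closed subgroup theorem cannot
  supply its Lie algebra. The tangent space is therefore built from continuous curves that are
  differentiable at a single parameter. This class is stable under products and reparametrization,
  and it is exactly what an open mapping theorem with differentiability at one point can digest. In
  a group, a conjugate of a one-parameter group is again one, with generator
  \<open>Ad(exp(r y)) x\<close>. Hence each loop closes with one further exponential, and its
  holonomy is a product of four matrix exponentials. Such small loops see only the curvature at the
  identity; in general the holonomy algebra is generated by curvature transported from all points,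
  but here the curvature at one point already has the full rank 28 = dim so(p,q). Left translation
  identifies all tangent spaces, so transports along open paths are matrices too, and statements
  about loops can be proved by induction over the pieces of a path.\<close>

section \<open>Calculus of matrix-valued functions\<close>

lemma bounded_bilinear_matrix_mult:
  "bounded_bilinear ((**) :: real ^ 'n ^ 'm \<Rightarrow> real ^ 'k ^ 'n \<Rightarrow> real ^ 'k ^ 'm)"
  unfolding bilinear_conv_bounded_bilinear[symmetric] bilinear_def
  by (auto intro!: linearI simp: matrix_matrix_mult_def vec_eq_iff algebra_simps sum.distrib
      sum_distrib_left)

lemmas matrix_mult_simps =
  bounded_bilinear.add_left[OF bounded_bilinear_matrix_mult]
  bounded_bilinear.add_right[OF bounded_bilinear_matrix_mult]
  bounded_bilinear.diff_left[OF bounded_bilinear_matrix_mult]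
  bounded_bilinear.diff_right[OF bounded_bilinear_matrix_mult]
  bounded_bilinear.minus_left[OF bounded_bilinear_matrix_mult]
  bounded_bilinear.minus_right[OF bounded_bilinear_matrix_mult]
  bounded_bilinear.scaleR_left[OF bounded_bilinear_matrix_mult]
  bounded_bilinear.scaleR_right[OF bounded_bilinear_matrix_mult]
  bounded_bilinear.zero_left[OF bounded_bilinear_matrix_mult]
  bounded_bilinear.zero_right[OF bounded_bilinear_matrix_mult]

lemmas continuous_on_matrix_mult [continuous_intros] =
  bounded_bilinear.continuous_on[OF bounded_bilinear_matrix_mult]

lemmas has_vector_derivative_matrix_mult =
  bounded_bilinear.has_vector_derivative[OF bounded_bilinear_matrix_mult]

lemma continuous_on_transpose [continuous_intros]:
  fixes f :: "_ \<Rightarrow> real ^ 'n ^ 'm"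
  assumes "continuous_on S f"
  shows "continuous_on S (\<lambda>x. transpose (f x))"
  unfolding transpose_def using assms by (intro continuous_intros)

lemma continuous_on_det [continuous_intros]:
  fixes f :: "_ \<Rightarrow> real ^ 'n ^ 'n"
  assumes "continuous_on S f"
  shows "continuous_on S (\<lambda>x. det (f x))"
  unfolding det_def using assms by (intro continuous_intros)

lemma has_vector_derivative_zero_imp_eq:
  fixes f :: "real \<Rightarrow> 'a::real_normed_vector"
  assumes "\<And>t. t \<in> S \<Longrightarrow> (f has_vector_derivative 0) (at t within S)" "convex S" "x \<in> S" "y \<in> S"
  shows "f x = f y"
proof -
  have "\<exists>c. \<forall>t\<in>S. f t = c"
    using assms(1) by (intro has_derivative_zero_constant \<open>convex S\<close>) (simp add:
        has_vector_derivative_def)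
  with assms(3,4) show ?thesis by auto
qed

lemma has_vector_derivative_vecI:
  fixes f :: "real \<Rightarrow> 'a::euclidean_space ^ 'n"
  assumes "\<And>i. ((\<lambda>t. f t $ i) has_vector_derivative f' $ i) (at t within S)"
  shows "(f has_vector_derivative f') (at t within S)"
proof -
  have "((\<lambda>t. f t \<bullet> b) has_derivative (\<lambda>h. (h *\<^sub>R f') \<bullet> b)) (at t within S)"
    if "b \<in> Basis" for b
  proof -
    from that obtain i u where b: "b = axis i u" by (auto simp: Basis_vec_def)
    show ?thesis
      using has_derivative_inner_left[OF assms[of i, unfolded has_vector_derivative_def], of u]
      by (simp add: b inner_axis)
  qed
  then show ?thesis
    unfolding has_vector_derivative_def
    by (subst has_derivative_componentwise_within) blast
qed

section \<open>One-parameter groups of matrices\<close>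

text \<open>The iterated product is \<open>**\<close>, since \<open>*\<close> on vectors acts
  entrywise.\<close>

definition mpow :: "real ^ 'n ^ 'n \<Rightarrow> nat \<Rightarrow> real ^ 'n ^ 'n" where
  "mpow A k = (((**) A) ^^ k) (mat 1)"

lemma mpow_0 [simp]: "mpow A 0 = mat 1"
  and mpow_Suc: "mpow A (Suc k) = A ** mpow A k"
  by (simp_all add: mpow_def)

lemma mpow_Suc_right: "mpow A (Suc k) = mpow A k ** A"
  by (induction k) (simp_all add: mpow_Suc matrix_mul_assoc)

text \<open>The operator bound \<open>K\<close> of A is submultiplicative, and an entry of a matrix
  is a component of the image of a basis vector. Geometric growth puts every entry of the
  exponential series under a scalar exponential series.\<close>

lemma mpow_bound: "\<exists>K. \<forall>k i j. \<bar>mpow A k $ i $ j\<bar> \<le> K ^ k"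
proof -
  obtain K where "0 < K" and K: "\<And>x. norm (A *v x) \<le> norm x * K"
    using bounded_linear.pos_bounded[OF matrix_vector_mul_bounded_linear[of A]] by blast
  have *: "norm (mpow A k *v x) \<le> K ^ k * norm x" for k x
  proof (induction k)
    case (Suc k)
    have "norm (mpow A (Suc k) *v x) \<le> norm (mpow A k *v x) * K"
      using K by (simp add: mpow_Suc flip: matrix_vector_mul_assoc)
    also have "\<dots> \<le> K ^ k * norm x * K"
      using Suc \<open>0 < K\<close> by (intro mult_right_mono) auto
    finally show ?case by (simp add: mult_ac)
  qed simp
  have "\<bar>mpow A k $ i $ j\<bar> \<le> K ^ k" for k i j
    using component_le_norm_cart[of "mpow A k *v axis j 1" i] *[of k "axis j 1"]
    by (simp add: matrix_vector_mul_component inner_axis)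
  then show ?thesis by blast
qed

text \<open>This is exp(t A). The parameter is kept apart from the matrix so that each entry is a
  scalar power series in \<open>t\<close>, which can be differentiated termwise.\<close>

definition mexp :: "real ^ 'n ^ 'n \<Rightarrow> real \<Rightarrow> real ^ 'n ^ 'n" where
  "mexp A t = (\<chi> i j. \<Sum>k. mpow A k $ i $ j / fact k * t ^ k)"

lemma summable_mexp: "summable (\<lambda>k. mpow A k $ i $ j / fact k * (t::real) ^ k)"
proof -
  obtain K where K: "\<And>k i j. \<bar>mpow A k $ i $ j\<bar> \<le> K ^ k"
    using mpow_bound by blast
  show ?thesis
  proof (rule summable_comparison_test')
    show "summable (\<lambda>k. inverse (fact k) * (K * \<bar>t\<bar>) ^ k)"
      by (rule summable_exp)
    show "norm (mpow A k $ i $ j / fact k * t ^ k) \<le> inverse (fact k) * (K * \<bar>t\<bar>) ^ k" for k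
      using mult_right_mono[OF K[of k i j], of "\<bar>t\<bar> ^ k / fact k"]
      by (simp add: abs_mult power_abs power_mult_distrib field_simps)
  qed
qed

lemma mexp_0 [simp]: "mexp A 0 = mat 1"
proof -
  have "(\<Sum>k. mpow A k $ i $ j / fact k * 0 ^ k) = mpow A 0 $ i $ j / fact 0" for i j
    by (rule powser_zero)
  then show ?thesis
    by (simp add: mexp_def vec_eq_iff)
qed

lemma mexp_component_derivative:
  "((\<lambda>t. mexp A t $ i $ j) has_real_derivative (\<Sum>k. mpow A (Suc k) $ i $ j / fact k * t ^ k)) (at
      t within S)"
proof -
  have "diffs (\<lambda>k. mpow A k $ i $ j / fact k) = (\<lambda>k. mpow A (Suc k) $ i $ j / fact k)"
    by (simp add: diffs_def fun_eq_iff field_simps del: of_nat_Suc)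
  then show ?thesis
    using termdiffs_strong_converges_everywhere[OF summable_mexp, of A i j t]
    by (simp add: mexp_def has_field_derivative_at_within)
qed

lemma mexp_derivative_left:
  "(mexp A has_vector_derivative A ** mexp A t) (at t within S)"
proof (intro has_vector_derivative_vecI)
  fix i j
  have "mpow A (Suc k) $ i $ j / fact k * t ^ k
      = (\<Sum>l\<in>UNIV. A $ i $ l * (mpow A k $ l $ j / fact k * t ^ k))" for k
    by (simp add: mpow_Suc matrix_matrix_mult_def sum_distrib_right sum_divide_distrib mult.assoc)
  moreover have "(\<lambda>k. \<Sum>l\<in>UNIV. A $ i $ l * (mpow A k $ l $ j / fact k * t ^ k))
      sums (\<Sum>l\<in>UNIV. A $ i $ l * mexp A t $ l $ j)"
    unfolding mexp_def vec_lambda_beta by (intro sums_sum sums_mult summable_sums summable_mexp)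
  ultimately have "(\<Sum>k. mpow A (Suc k) $ i $ j / fact k * t ^ k) = (A ** mexp A t) $ i $ j"
    by (simp add: sums_iff matrix_matrix_mult_def)
  then show "((\<lambda>t. mexp A t $ i $ j) has_vector_derivative (A ** mexp A t) $ i $ j) (at t within S)"
    using mexp_component_derivative[of A i j t S]
    by (simp add: has_real_derivative_iff_has_vector_derivative)
qed

lemma mexp_derivative_right:
  "(mexp A has_vector_derivative mexp A t ** A) (at t within S)"
proof (intro has_vector_derivative_vecI)
  fix i j
  have "mpow A (Suc k) $ i $ j / fact k * t ^ k
      = (\<Sum>l\<in>UNIV. (mpow A k $ i $ l / fact k * t ^ k) * A $ l $ j)" for k
    by (simp add: mpow_Suc_right matrix_matrix_mult_def sum_distrib_left sum_distrib_right
        sum_divide_distrib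
        mult_ac)
  moreover have "(\<lambda>k. \<Sum>l\<in>UNIV. (mpow A k $ i $ l / fact k * t ^ k) * A $ l $ j)
      sums (\<Sum>l\<in>UNIV. mexp A t $ i $ l * A $ l $ j)"
    unfolding mexp_def vec_lambda_beta by (intro sums_sum sums_mult2 summable_sums summable_mexp)
  ultimately have "(\<Sum>k. mpow A (Suc k) $ i $ j / fact k * t ^ k) = (mexp A t ** A) $ i $ j"
    by (simp add: sums_iff matrix_matrix_mult_def)
  then show "((\<lambda>t. mexp A t $ i $ j) has_vector_derivative (mexp A t ** A) $ i $ j) (at t within S)"
    using mexp_component_derivative[of A i j t S]
    by (simp add: has_real_derivative_iff_has_vector_derivative)
qed

lemma mexp_scaled_derivative_left:
  "((\<lambda>t. mexp A (c * t)) has_vector_derivative c *\<^sub>R (A ** mexp A (c * t))) (at t within S)"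
  using vector_diff_chain_within[of "\<lambda>t. c * t" c t S "mexp A"] mexp_derivative_left[of A "c * t"]
  by (simp add: o_def) (auto intro!: derivative_eq_intros simp flip:
      has_real_derivative_iff_has_vector_derivative)

lemma mexp_scaled_derivative_right:
  "((\<lambda>t. mexp A (c * t)) has_vector_derivative c *\<^sub>R (mexp A (c * t) ** A)) (at t within S)"
  using vector_diff_chain_within[of "\<lambda>t. c * t" c t S "mexp A"] mexp_derivative_right[of A "c * t"]
  by (simp add: o_def) (auto intro!: derivative_eq_intros simp flip:
      has_real_derivative_iff_has_vector_derivative)

text \<open>Differentiating the left factor with A on its right and the right factor with A on its
  left gives two terms exp(-t A) A exp(t A) of opposite sign. The product is therefore constant,
  equal to its value at 0.\<close>

lemma mexp_uminus_mult: "mexp A (- t) ** mexp A t = mat 1"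
proof -
  have "((\<lambda>t. mexp A (- t) ** mexp A t) has_vector_derivative 0) (at t)" for t
    using has_vector_derivative_matrix_mult[OF mexp_scaled_derivative_right[of A "-1" t UNIV]
        mexp_derivative_left[of A t UNIV]]
    by (simp add: matrix_mult_simps matrix_mul_assoc)
  from has_vector_derivative_zero_imp_eq[of UNIV, OF this, of t 0] show ?thesis
    by simp
qed

lemma continuous_on_mexp [continuous_intros]:
  assumes "continuous_on S f"
  shows "continuous_on S (\<lambda>x. mexp A (f x))"
proof -
  have "continuous_on UNIV (mexp A)"
    using mexp_derivative_left
    by (intro continuous_at_imp_continuous_on ballI) (rule has_vector_derivative_continuous)
  then show ?thesis
    using continuous_on_compose2[OF _ assms] by blast
qed

section \<open>Tangent vectors of a monoid of matrices\<close>

text \<open>In finite dimension a subspace is its own double orthogonal complement. Membership is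
  thus tested by linear functionals, which commute with derivatives and can be rewritten as pairings
  with bivectors.\<close>

lemma subspace_memI_orthogonal:
  fixes S :: "'a::euclidean_space set"
  assumes "subspace S" and "\<And>a. (\<And>y. y \<in> S \<Longrightarrow> a \<bullet> y = 0) \<Longrightarrow> a \<bullet> x = 0"
  shows "x \<in> S"
proof -
  have "x \<in> S\<^sup>\<bottom>\<^sup>\<bottom>"
    using assms(2) by (auto simp: orthogonal_comp_def orthogonal_def inner_commute)
  then show ?thesis
    using orthogonal_comp_self[OF assms(1)] by simp
qed

text \<open>Every functional vanishing on \<open>S\<close> vanishes along the curve, hence on its
  derivative. This keeps the second differentiation of the loop holonomies inside the tangent
  space.\<close>

lemma subspace_has_vector_derivative:
  fixes S :: "'a::euclidean_space set"
  assumes "subspace S" and "\<And>r. F r \<in> S" and "(F has_vector_derivative X) (at t)"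
  shows "X \<in> S"
proof (rule subspace_memI_orthogonal[OF assms(1)])
  fix a assume "\<And>y. y \<in> S \<Longrightarrow> a \<bullet> y = 0"
  then have "(\<lambda>r. a \<bullet> F r) = (\<lambda>r. 0)"
    using assms(2) by simp
  moreover have "((\<lambda>r. a \<bullet> F r) has_vector_derivative a \<bullet> X) (at t)"
    by (rule bounded_linear.has_vector_derivative[OF bounded_linear_inner_right assms(3)])
  ultimately have "((\<lambda>r. 0) has_vector_derivative a \<bullet> X) (at t)"
    by simp
  then show "a \<bullet> X = 0"
    using has_vector_derivative_const vector_derivative_unique_at by blast
qed

text \<open>Differentiability is required at 0 only, but continuity everywhere: the chart assembled
  from such curves has to be continuous on a whole neighbourhood for the open mapping
  theorem.\<close>

definition tangent :: "(real ^ 'n ^ 'n) set \<Rightarrow> (real ^ 'n ^ 'n) set" where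
  "tangent H = {X. \<exists>a. (\<forall>t. a t \<in> H) \<and> continuous_on UNIV a
      \<and> a 0 = mat 1 \<and>
     (a has_vector_derivative X) (at 0)}"

locale matrix_monoid =
  fixes H :: "(real ^ 'n ^ 'n) set"
  assumes one_mem: "mat 1 \<in> H" and mult_mem: "A \<in> H \<Longrightarrow> B \<in> H \<Longrightarrow> A ** B \<in> H"
begin

text \<open>Sums come from pointwise products of curves and multiples from rescaling the parameter.
  Negative multiples come from reversing it, which is why a monoid suffices.\<close>

lemma subspace_tangent: "subspace (tangent H)"
proof (rule subspaceI)
  show "0 \<in> tangent H"
    unfolding tangent_def using one_mem
    by (auto intro!: exI[of _ "\<lambda>t. mat 1"] simp: has_vector_derivative_const)
next
  fix X Y assume "X \<in> tangent H" "Y \<in> tangent H"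
  then obtain a b where a: "\<And>t. a t \<in> H" "continuous_on UNIV a" "a 0 = mat 1"
      "(a has_vector_derivative X) (at 0)"
    and b: "\<And>t. b t \<in> H" "continuous_on UNIV b" "b 0 = mat 1" "(b has_vector_derivative Y) (at 0)"
    unfolding tangent_def by blast
  have "((\<lambda>t. a t ** b t) has_vector_derivative X + Y) (at 0)"
    using has_vector_derivative_matrix_mult[OF a(4) b(4)] by (simp add: a b add.commute)
  then show "X + Y \<in> tangent H"
    unfolding tangent_def using a b
    by (auto intro!: exI[of _ "\<lambda>t. a t ** b t"] mult_mem continuous_intros)
next
  fix c X assume "X \<in> tangent H"
  then obtain a where a: "\<And>t. a t \<in> H" "continuous_on UNIV a" "a 0 = mat 1"
      "(a has_vector_derivative X) (at 0)"
    unfolding tangent_def by blast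
  have "((\<lambda>t. c * t) has_vector_derivative c) (at 0)"
    by (auto intro!: derivative_eq_intros simp flip: has_real_derivative_iff_has_vector_derivative)
  then have "((\<lambda>t. a (c * t)) has_vector_derivative c *\<^sub>R X) (at 0)"
    using vector_diff_chain_at[of "\<lambda>t. c * t" c 0 a X] a(4) by (simp add: o_def)
  moreover have "continuous_on UNIV (\<lambda>t. a (c * t))"
    by (rule continuous_on_compose2[OF a(2)]) (auto intro!: continuous_intros)
  ultimately show "c *\<^sub>R X \<in> tangent H"
    unfolding tangent_def using a by (auto intro!: exI[of _ "\<lambda>t. a (c * t)"])
qed

text \<open>These are coordinates of the second kind: the product over \<open>b\<close> of the
  curves for \<open>X b\<close>, each run up to the coordinate \<open>Y \<bullet> b\<close>. All
  factors are 1 at the origin, so the product rule adds their derivatives.\<close>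

lemma tangent_chart:
  fixes X :: "'a::euclidean_space \<Rightarrow> real ^ 'n ^ 'n"
  assumes "finite B" and "\<And>b. b \<in> B \<Longrightarrow> X b \<in> tangent H"
  shows "\<exists>\<Phi>. (\<forall>Y. \<Phi> Y \<in> H) \<and> continuous_on UNIV \<Phi>
      \<and> \<Phi> 0 = mat 1 \<and>
    (\<Phi> has_derivative (\<lambda>Y. \<Sum>b\<in>B. (Y \<bullet> b) *\<^sub>R X b)) (at 0)"
  using assms
proof (induction B rule: finite_induct)
  case empty
  show ?case
    using one_mem by (auto intro!: exI[of _ "\<lambda>Y. mat 1"])
next
  case (insert b B)
  then obtain \<Phi> where \<Phi>: "\<And>Y. \<Phi> Y \<in> H" "continuous_on UNIV \<Phi>" "\<Phi> 0 = mat 1"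
      "(\<Phi> has_derivative (\<lambda>Y. \<Sum>b\<in>B. (Y \<bullet> b) *\<^sub>R X b)) (at 0)"
    by blast
  from insert.prems obtain a where a: "\<And>t. a t \<in> H" "continuous_on UNIV a" "a 0 = mat 1"
      "(a has_vector_derivative X b) (at 0)"
    unfolding tangent_def by blast
  have "((\<lambda>Y. a (Y \<bullet> b)) has_derivative (\<lambda>Y. (Y \<bullet> b) *\<^sub>R X b)) (at 0)"
    using diff_chain_at[of "\<lambda>Y. Y \<bullet> b" "\<lambda>Y. Y \<bullet> b" 0 a] a(4)
    by (simp add: has_vector_derivative_def o_def bounded_linear_imp_has_derivative
        bounded_linear_inner_left)
  from bounded_bilinear.FDERIV[OF bounded_bilinear_matrix_mult this \<Phi>(4)]
  have "((\<lambda>Y. a (Y \<bullet> b) ** \<Phi> Y) has_derivative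
      (\<lambda>Y. \<Sum>b\<in>insert b B. (Y \<bullet> b) *\<^sub>R X b)) (at 0)"
    using insert.hyps by (simp add: a \<Phi> add.commute)
  moreover have "continuous_on UNIV (\<lambda>Y. a (Y \<bullet> b) ** \<Phi> Y)"
    by (intro continuous_intros \<Phi> continuous_on_compose2[OF a(2)]) auto
  ultimately show ?case
    using a \<Phi> by (intro exI[of _ "\<lambda>Y. a (Y \<bullet> b) ** \<Phi> Y"]) (auto intro!: mult_mem)
qed

text \<open>A chart of \<open>H\<close> along the skew matrices, multiplied by \<open>1 + S\<close> with \<open>S\<close>
  self-adjoint, covers a neighbourhood of the identity in the space of all matrices; an isometry forces \<open>S = 0\<close>.\<close>

lemma isometries_near_one_mem:
  fixes G :: "real ^ 'n ^ 'n"
  assumes G: "transpose G = G" "invertible G"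
    and H: "\<And>A. A \<in> H \<Longrightarrow> transpose A ** G ** A = G"
    and skew: "\<And>Z. transpose Z ** G + G ** Z = 0 \<Longrightarrow> Z \<in> tangent H"
  shows "\<exists>U. open U \<and> mat 1 \<in> U
      \<and> (\<forall>A\<in>U. transpose A ** G ** A = G \<longrightarrow> A \<in> H)"
proof -
  obtain G' where G': "G ** G' = mat 1" "G' ** G = mat 1"
    using G(2) unfolding invertible_def by blast
  have G'G: "A ** G ** G' = A" "A ** G' ** G = A" for A
    by (simp_all add: G' flip: matrix_mul_assoc)
  have "transpose G' = G' ** G ** transpose G'"
    by (simp add: G')
  also have "\<dots> = G' ** transpose (G' ** G)"
    by (simp add: matrix_transpose_mul G matrix_mul_assoc)
  finally have tG': "transpose G' = G'"
    by (simp add: G')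
  have t_add: "transpose (A + B) = transpose A + transpose B"
    and t_diff: "transpose (A - B) = transpose A - transpose B" for A B :: "real ^ 'n ^ 'n"
    by (simp_all add: transpose_def vec_eq_iff)
  \<comment> \<open>\<open>G' ** transpose Y ** G\<close> is the adjoint of \<open>Y\<close> with
    respect to \<open>G\<close>. So \<open>P\<close> projects onto the skew part, and
    \<open>Y - P Y\<close> is the self-adjoint part.\<close>
  define P where "P Y = (1/2) *\<^sub>R (Y - G' ** transpose Y ** G)" for Y
  have P_mem: "P Y \<in> tangent H" for Y
    by (intro skew) (simp add: P_def t_diff matrix_transpose_mul transpose_scalar G tG'
        matrix_mult_simps matrix_mul_assoc G' G'G flip: scaleR_right_distrib)
  have linP: "linear P"
    unfolding P_def by (intro linearI) (simp_all add: t_add transpose_scalar matrix_mult_simps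
        algebra_simps)
  obtain \<Phi> where \<Phi>: "\<And>Y. \<Phi> Y \<in> H" "continuous_on UNIV \<Phi>" "\<Phi> 0 = mat 1"
      "(\<Phi> has_derivative (\<lambda>Y. \<Sum>b\<in>Basis. (Y \<bullet> b) *\<^sub>R P b)) (at 0)"
    using tangent_chart[OF finite_Basis, of P, OF P_mem] by (elim exE conjE) blast
  have "(\<lambda>Y. \<Sum>b\<in>Basis. (Y \<bullet> b) *\<^sub>R P b) = (\<lambda>Y. P (\<Sum>b\<in>Basis. (Y \<bullet> b) *\<^sub>R b))"
    by (simp add: linear_sum[OF linP] linear_scale[OF linP] del: euclidean_representation)
  also have "\<dots> = P"
    unfolding euclidean_representation ..
  finally have "(\<lambda>Y. \<Sum>b\<in>Basis. (Y \<bullet> b) *\<^sub>R P b) = P" .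
  with \<Phi> have d\<Phi>: "(\<Phi> has_derivative P) (at 0)"
    by simp
  have blP: "bounded_linear P"
    using linP linear_conv_bounded_linear by blast
  have contP: "continuous_on S P" for S
    by (rule linear_continuous_on[OF blP])
  define \<Psi> where "\<Psi> Y = \<Phi> Y ** (mat 1 + (Y - P Y))" for Y
  \<comment> \<open>For self-adjoint S the isometry condition on 1 + S becomes S (2 + S) = 0.
    Restricting to \<open>T\<close>, where 2 + S is invertible, leaves S = 0 as the only solution;
    \<open>mat 2\<close> is twice the identity.\<close>
  define T where "T = {Y. det (mat 2 + (Y - P Y)) \<noteq> 0}"
  have "open T"
    unfolding T_def
    by (rule open_Collect_neq) (auto intro!: continuous_intros contP)
  moreover have "0 \<in> T"
    using linear_0[OF linP] by (simp add: T_def det_diagonal mat_def)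
  ultimately have "0 \<in> interior T"
    by (simp add: interior_open)
  have "((\<lambda>Y. mat 1 + (Y - P Y)) has_derivative (\<lambda>Y. Y - P Y)) (at 0)"
    by (auto intro!: derivative_eq_intros bounded_linear_imp_has_derivative[OF blP])
  \<comment> \<open>The chart contributes the skew part \<open>P\<close> and the second factor the
    complementary part, so the two derivatives add up to the identity.\<close>
  from bounded_bilinear.FDERIV[OF bounded_bilinear_matrix_mult d\<Phi> this]
  have "(\<Psi> has_derivative id) (at 0)"
    using linear_0[OF linP] by (simp add: \<Psi>_def [abs_def] \<Phi> id_def)
  moreover have "continuous_on UNIV \<Psi>"
    unfolding \<Psi>_def[abs_def] by (intro continuous_intros \<Phi> contP)
  ultimately have "\<Psi> 0 \<in> interior (\<Psi> ` T)"
    using \<open>0 \<in> interior T\<close>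
    by (intro sussmann_open_mapping[of UNIV \<Psi> 0 id id T]) (auto simp: id_def bounded_linear_ident)
  then have "mat 1 \<in> interior (\<Psi> ` T)"
    using linear_0[OF linP] by (simp add: \<Psi>_def \<Phi>)
  moreover have "A \<in> H" if A: "A \<in> interior (\<Psi> ` T)" "transpose A ** G ** A = G" for A
  proof -
    obtain Y where Y: "det (mat 2 + (Y - P Y)) \<noteq> 0" "A = \<Psi> Y"
      using A(1) interior_subset unfolding T_def by blast
    define S where "S = Y - P Y"
    have "S = (1/2) *\<^sub>R (Y + G' ** transpose Y ** G)"
      by (simp add: S_def P_def vec_eq_iff field_simps)
    then have S: "transpose S ** G = G ** S"
      by (simp add: t_add matrix_transpose_mul transpose_scalar G tG' matrix_mult_simps
          matrix_mul_assoc G' G'G add.commute)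
    have "transpose (mat 1 + S) ** G ** (mat 1 + S)
        = transpose (mat 1 + S) ** (transpose (\<Phi> Y) ** G ** \<Phi> Y) ** (mat 1 + S)"
      by (simp add: H \<Phi>)
    also have "\<dots> = transpose A ** G ** A"
      by (simp add: Y \<Psi>_def S_def matrix_transpose_mul matrix_mul_assoc)
    finally have "(mat 1 + transpose S) ** G ** (mat 1 + S) = G"
      using A by (simp add: t_add)
    then have *: "G ** S + G ** S + G ** S ** S = 0"
      by (simp add: matrix_mult_simps S matrix_mul_assoc)
    have "mat 2 = (mat 1 + mat 1 :: real ^ 'n ^ 'n)"
      by (simp add: vec_eq_iff mat_def)
    then have "G ** (S ** (mat 2 + S)) = 0"
      using * by (simp only: matrix_mult_simps matrix_mul_rid matrix_mul_assoc)
    then have "G' ** (G ** (S ** (mat 2 + S))) = 0"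
      by (simp add: matrix_mult_simps)
    then have "S ** (mat 2 + S) = 0"
      by (simp add: matrix_mul_assoc G')
    moreover obtain R where "(mat 2 + S) ** R = mat 1"
      using Y(1) unfolding S_def[symmetric] invertible_det_nz[symmetric] invertible_def by blast
    ultimately have "S = 0"
      by (metis matrix_mul_assoc matrix_mul_rid matrix_mult_simps(9))
    then show "A \<in> H"
      using \<Phi>(1)[of Y] by (simp add: Y \<Psi>_def S_def)
  qed
  ultimately show ?thesis
    by (intro exI[of _ "interior (\<Psi> ` T)"]) auto
qed

end

section \<open>The holonomy group of a left-invariant metric\<close>

text \<open>Induction on the later path. Matrices compose like maps, so the later transport stands
  on the left.\<close>

lemma transport_append:
  assumes "transport b g q r B" and "transport b g p q A"
  shows "transport b g p r (B ** A)"
  using assms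
proof (induction rule: transport.induct)
  case refl
  then show ?case by simp
next
  case (step q s B c C r)
  then show ?case
    by (auto simp flip: matrix_mul_assoc intro: transport.step)
qed

lemma matrix_monoid_holonomy_group: "matrix_monoid (holonomy_group b g)"
  by unfold_locales (auto simp: holonomy_group_def intro: transport.refl transport_append)

section \<open>The group of \<open>n8\<close>, its exponential curves and their parallel
  transport\<close>

interpretation n8: bounded_bilinear n8
  using n8_lie_algebra(1) bilinear_conv_bounded_bilinear by blast

lemma bch_n8_scaleR: "bch n8 (s *\<^sub>R x) (t *\<^sub>R x) = (s + t) *\<^sub>R x"
  by (rule vec8_eqI) (simp_all add: bch_def n8_nth wedge_def algebra_simps)

text \<open>Only the terms of the group product that are linear in the second factor survive at 0;
  the double bracket \<open>n8 x (n8 x p)\<close> is quadratic.\<close>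

lemma left_translation_deriv_n8:
  "left_translation_deriv n8 p x = x + (1/2) *\<^sub>R n8 p x + (1/12) *\<^sub>R n8 p (n8 p x)"
proof -
  note [derivative_intros] = bounded_bilinear.FDERIV[OF n8.bounded_bilinear_axioms]
  have "(bch n8 p has_derivative (\<lambda>x. x + (1/2) *\<^sub>R n8 p x
      + (1/12) *\<^sub>R n8 p (n8 p x))) (at 0)"
    unfolding bch_def[abs_def]
    by (auto intro!: derivative_eq_intros simp: n8.zero_left n8.zero_right)
  then show ?thesis
    unfolding left_translation_deriv_def by (simp add: frechet_derivative_at[symmetric])
qed

text \<open>The curve p exp(t x) is an integral curve of the left-invariant field \<open>x\<close>:
  in the left trivialization its velocity is the constant \<open>x\<close>, whatever the starting
  point.\<close>

lemma bch_n8_curve_derivative: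
  "((\<lambda>t. bch n8 p (t *\<^sub>R x)) has_vector_derivative
     left_translation_deriv n8 (bch n8 p (t *\<^sub>R x)) x) (at t within S)"
proof -
  have n8_self: "n8 (c *\<^sub>R x) x = 0" "n8 x (c *\<^sub>R x) = 0" for c
    by (simp_all add: n8.scaleR_left n8.scaleR_right n8_lie_algebra(2))
  have eq: "bch n8 p (t *\<^sub>R x) = p + t *\<^sub>R (x + (1/2) *\<^sub>R n8 p x
      + (1/12) *\<^sub>R n8 p (n8 p x))
      + t\<^sup>2 *\<^sub>R ((1/12) *\<^sub>R n8 x (n8 x p))" for t
    by (simp add: bch_def n8.scaleR_left n8.scaleR_right power2_eq_square algebra_simps)
  have "((\<lambda>t. bch n8 p (t *\<^sub>R x)) has_vector_derivative
      x + (1/2) *\<^sub>R n8 p x + (1/12) *\<^sub>R n8 p (n8 p x)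
          + (2 * t) *\<^sub>R ((1/12) *\<^sub>R n8 x (n8 x p))) (at t within S)"
    unfolding eq
    by (auto intro!: derivative_eq_intros simp: has_vector_derivative_def algebra_simps)
  also have "x + (1/2) *\<^sub>R n8 p x + (1/12) *\<^sub>R n8 p (n8 p x)
      + (2 * t) *\<^sub>R ((1/12) *\<^sub>R n8 x (n8 x p))
      = left_translation_deriv n8 (bch n8 p (t *\<^sub>R x)) x"
    unfolding left_translation_deriv_n8
    by (rule vec8_eqI; simp add: bch_def n8_nth wedge_def; simp add: field_simps)
  finally show ?thesis .
qed

text \<open>This is exp(y) exp(x) exp(-y) = exp(Ad(exp y) x), where Ad(exp y) is the exponential of
  the adjoint action of \<open>y\<close>, cut off after the quadratic term by nilpotency.\<close>

lemma bch_n8_conjugate: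
  "bch n8 (bch n8 y x) (- y) = x + n8 y x + (1/2) *\<^sub>R n8 y (n8 y x)"
  by (rule vec8_eqI; simp add: bch_def n8_nth wedge_def; simp add: field_simps)

text \<open>Replacing the definite description \<open>levi_civita\<close> by a given bilinear
  \<open>D\<close> makes the holonomy argument common to all four metrics.\<close>

locale n8_connection =
  fixes g :: "real ^ 8 \<Rightarrow> real ^ 8 \<Rightarrow> real" and D :: "real ^ 8 \<Rightarrow> real ^ 8 \<Rightarrow> real ^ 8"
  assumes levi_civita: "levi_civita n8 g = D" and bilinear: "bilinear D"
begin

definition M :: "real ^ 8 \<Rightarrow> real ^ 8 ^ 8" where
  "M x = matrix (D x)"

lemma M_works [simp]: "M x *v z = D x z"
  using bilinear by (simp add: M_def matrix_works bilinear_def)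

lemma linear_M: "linear M"
  using bilinear
  by (intro linearI) (simp_all add: matrix_eq bilinear_ladd bilinear_lmul algebra_simps flip:
      scaleR_matrix_vector_assoc)

text \<open>The left-trivialized velocity is the constant \<open>t *\<^sub>R x\<close>, so the
  transport equation has constant coefficients and a matrix exponential solves it from every initial
  vector.\<close>

lemma transport_exp: "transport n8 g p (bch n8 p (t *\<^sub>R x)) (mexp (M x) (- t))"
proof -
  have "transport_along n8 g (\<lambda>\<tau>. bch n8 p (\<tau> *\<^sub>R (t *\<^sub>R x))) (mexp (M x) (- t))"
    unfolding transport_along_def
  proof (rule exI[of _ "\<lambda>_. t *\<^sub>R x"], intro conjI ballI allI)
    fix v
    have "((\<lambda>\<tau>. mexp (M x) (- t * \<tau>) *v v) has_vector_derivative

            - levi_civita n8 g (t *\<^sub>R x) (mexp (M x) (- t * \<tau>) *v v)) (at \<tau> within {0..1})" for \<tau>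
    proof -
      have "linear (\<lambda>A :: real ^ 8 ^ 8. A *v v)"
        by (intro linearI) (simp_all add: algebra_simps flip: scaleR_matrix_vector_assoc)
      then have "bounded_linear (\<lambda>A :: real ^ 8 ^ 8. A *v v)"
        using linear_conv_bounded_linear by blast
      moreover have "((- t) *\<^sub>R (M x ** E)) *v v =
          - levi_civita n8 g (t *\<^sub>R x) (E *v v)" for E
        by (simp only: levi_civita bilinear_lmul[OF bilinear] scaleR_matrix_vector_assoc[symmetric]
            matrix_vector_mul_assoc[symmetric] M_works) simp
      ultimately show ?thesis
        using bounded_linear.has_vector_derivative[OF _ mexp_scaled_derivative_left[of "M x" "- t"
            \<tau> "{0..1}"],
            of "\<lambda>A. A *v v"]
        by (simp only:)
    qed
    then show "\<exists>V. V 0 = v \<and> V 1 = mexp (M x) (- t) *v v \<and>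
        (\<forall>\<tau>\<in>{0..1}. (V has_vector_derivative
            - levi_civita n8 g (t *\<^sub>R x) (V \<tau>)) (at \<tau> within {0..1}))"
      by (intro exI[of _ "\<lambda>\<tau>. mexp (M x) (- t * \<tau>) *v v"]) simp
  qed (rule continuous_on_const bch_n8_curve_derivative)+
  from transport.step[OF transport.refl this] show ?thesis
    by (simp add: bch_n8_group)
qed

lemma matrix_curvature_works: "matrix (curvature n8 g x y) *v z = curvature n8 g x y z"
proof -
  have "linear (curvature n8 g x y)"
    using bilinear
    by (intro linearI)
      (simp_all add: curvature_def Let_def levi_civita bilinear_radd bilinear_rmul algebra_simps)
  then show ?thesis
    by (simp add: matrix_works)
qed

text \<open>The loop runs along the exponentials of \<open>r y\<close>, \<open>t x\<close>, \<open>- r y\<close>, and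
  closes up along \<open>- t Ad(exp(r y)) x\<close>. Differentiating its holonomy in \<open>t\<close> and then in \<open>r\<close> gives the curvature.\<close>

lemma curvature_tangent: "matrix (curvature n8 g y x) \<in> tangent (holonomy_group n8 g)"
proof -
  interpret H: matrix_monoid "holonomy_group n8 g"
    by (rule matrix_monoid_holonomy_group)
  define ad where "ad r = x + r *\<^sub>R n8 y x + (r\<^sup>2 / 2) *\<^sub>R n8 y (n8 y x)" for r
  \<comment> \<open>The derivative at t = 0 of the holonomy \<open>a\<close> of the loop with
    parameters r and t, hence a tangent vector for every fixed r.\<close>
  define X where "X r = M (ad r) - mexp (M y) r ** M x ** mexp (M y) (- r)" for r
  have "X r \<in> tangent (holonomy_group n8 g)" for r
  proof -
    define a where "a t = mexp (M (ad r)) t ** (mexp (M y) r ** (mexp (M x) (- t) ** mexp (M y) (-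
        r)))" for t
    have hol: "a t \<in> holonomy_group n8 g" for t
    proof -
      have "transport n8 g 0 (r *\<^sub>R y) (mexp (M y) (- r))"
        using transport_exp[of 0 r y] by (simp add: bch_n8_group)
      note transport_append[OF transport_exp this, of t x]
      note transport_append[OF transport_exp this, of "- r" y]
      note transport_append[OF transport_exp this, of "- t" "ad r"]
      moreover have "bch n8 (bch n8 (r *\<^sub>R y) (t *\<^sub>R x)) (- r *\<^sub>R y) = t *\<^sub>R ad r"
        using bch_n8_conjugate[of "r *\<^sub>R y" "t *\<^sub>R x"]
        by (simp add: ad_def n8.scaleR_left n8.scaleR_right power2_eq_square algebra_simps)
      ultimately show ?thesis
        using bch_n8_scaleR[of t "ad r" "- t"] by (simp add: holonomy_group_def a_def)
    qed
    have one: "mexp (M y) r ** mexp (M y) (- r) = mat 1"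
      using mexp_uminus_mult[of "M y" "- r"] by simp
    have "((\<lambda>t. mexp (M x) (- 1 * t)) has_vector_derivative - M x) (at 0)"
      using mexp_scaled_derivative_left[of "M x" "- 1" 0] by simp
    from has_vector_derivative_matrix_mult[OF mexp_derivative_left[of "M (ad r)"]
        has_vector_derivative_matrix_mult[OF has_vector_derivative_const[of "mexp (M y) r"]
          has_vector_derivative_matrix_mult[OF this has_vector_derivative_const[of "mexp (M y) (-
              r)"]]]]
    have "(a has_vector_derivative X r) (at 0)"
      by (simp add: a_def[abs_def] X_def one matrix_mult_simps matrix_mul_assoc)
    moreover have "continuous_on UNIV a"
      unfolding a_def[abs_def] by (intro continuous_intros)
    moreover have "a 0 = mat 1"
      by (simp add: a_def one)
    ultimately show ?thesis
      unfolding tangent_def using hol by blast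
  qed
  \<comment> \<open>At r = 0 the derivative is the connection along the bracket minus the commutator
    of the two connection matrices, that is, minus the curvature. The sign is removed at the end
    because the tangent space is a subspace.\<close>
  moreover have "(X has_vector_derivative - matrix (curvature n8 g y x)) (at 0)"
  proof -
    have M_ad: "M (ad r) = M x + r *\<^sub>R M (n8 y x)
        + (r\<^sup>2 / 2) *\<^sub>R M (n8 y (n8 y x))" for r
      by (simp add: ad_def linear_add[OF linear_M] linear_scale[OF linear_M])
    have "((\<lambda>r. mexp (M y) (- 1 * r)) has_vector_derivative - M y) (at 0)"
      using mexp_scaled_derivative_left[of "M y" "- 1" 0] by simp
    moreover have "((\<lambda>r. M (ad r)) has_vector_derivative M (n8 y x)) (at 0)"
      unfolding M_ad by (auto intro!: derivative_eq_intros simp: has_vector_derivative_def)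
    moreover have "((\<lambda>r. mexp (M y) r ** M x) has_vector_derivative M y ** M x) (at 0)"
      using has_vector_derivative_matrix_mult[OF mexp_derivative_left[of "M y" 0 UNIV]
          has_vector_derivative_const]
      by (simp add: matrix_mult_simps)
    ultimately have "(X has_vector_derivative M (n8 y x) - (M y ** M x - M x ** M y)) (at 0)"
      unfolding X_def[abs_def]
      by (auto intro!: derivative_eq_intros has_vector_derivative_matrix_mult
          simp: matrix_mult_simps)
    moreover have "M (n8 y x) - (M y ** M x - M x ** M y) = - matrix (curvature n8 g y x)"
    proof -
      have "(- A) *v z = - (A *v z)" for A :: "real ^ 8 ^ 8" and z
        by (simp add: matrix_vector_mult_def vec_eq_iff sum_negf)
      then show ?thesis
        by (simp add: matrix_eq matrix_vector_mult_diff_rdistrib matrix_curvature_works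
            curvature_def Let_def levi_civita flip: matrix_vector_mul_assoc)
    qed
    ultimately show ?thesis by simp
  qed
  ultimately have "- matrix (curvature n8 g y x) \<in> tangent (holonomy_group n8 g)"
    using subspace_has_vector_derivative[OF H.subspace_tangent] by blast
  from subspace_neg[OF H.subspace_tangent this] show ?thesis by simp
qed

end

section \<open>Diagonal forms and the group SO(p,q)\<close>

lemma inner_transpose_matrix_vector:
  fixes A :: "real ^ 'n ^ 'm"
  shows "x \<bullet> (transpose A *v y) = (A *v x) \<bullet> y"
  by (metis dot_lmul_matrix inner_commute transpose_matrix_vector)

lemma diag_pq_symmetric: "transpose (diag_pq p q) = diag_pq p q"
  by (simp add: diag_pq_def transpose_def vec_eq_iff)

text \<open>For p + q = 8 the two index ranges together exhaust the integers modulo 8 (with 8 = 0),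
  so no diagonal entry takes the default value 0 and each is 1 or -1.\<close>

lemma diag_pq_square:
  assumes "p + q = 8"
  shows "diag_pq p q ** diag_pq p q = mat 1"
proof -
  have "i \<in> of_nat ` {1..8}" for i :: 8
  proof -
    have "k \<in> of_nat ` {1..8}" if "k = of_nat m" "m \<in> {1..8}" for k :: 8 and m :: nat
      using that by blast
    from this[of i 1] this[of i 2] this[of i 3] this[of i 4] this[of i 5] this[of i 6] this[of i 7]
      this[of i 8] ex8[of i]
    show ?thesis by auto
  qed
  moreover have "{1..8} = {1..p} \<union> {p+1..p+q}"
    using assms by auto
  ultimately have "i \<in> of_nat ` {1..p} \<or> i \<in> of_nat ` {p+1..p+q}" for i :: 8
    by (metis Un_iff image_Un)
  then have "diag_pq p q $ i $ j * diag_pq p q $ j $ k = (if i = j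
      \<and> j = k then 1 else 0)" for i j k
    by (auto simp: diag_pq_def)
  then have "(diag_pq p q ** diag_pq p q) $ i $ k = (\<Sum>j\<in>UNIV. if i = j then (if i = k then 1 else
      0) else 0)"
    for i k
    unfolding matrix_matrix_mult_def vec_lambda_beta by (intro sum.cong) auto
  then show ?thesis
    by (simp add: vec_eq_iff mat_def)
qed

lemma det_diag_pq: "p + q = 8 \<Longrightarrow> det (diag_pq p q) \<noteq> 0"
  using diag_pq_square[of p q] det_mul[of "diag_pq p q" "diag_pq p q"] by auto

lemma SO_mult: "A \<in> SO p q \<Longrightarrow> B \<in> SO p q \<Longrightarrow> A ** B \<in> SO p q"
proof -
  assume "A \<in> SO p q" "B \<in> SO p q"
  then have A: "transpose A ** diag_pq p q ** A = diag_pq p q" "det A = 1"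
    and B: "transpose B ** diag_pq p q ** B = diag_pq p q" "det B = 1"
    by (auto simp: SO_def)
  have "transpose (A ** B) ** diag_pq p q ** (A ** B)
      = transpose B ** (transpose A ** diag_pq p q ** A) ** B"
    by (simp add: matrix_transpose_mul matrix_mul_assoc)
  with A B show "A ** B \<in> SO p q"
    by (simp add: SO_def det_mul)
qed

lemma one_mem_SO: "mat 1 \<in> SO p q"
  by (simp add: SO_def)

lemma SO_plus_subset_SO: "SO_plus p q \<subseteq> SO p q"
  by (simp add: SO_plus_def connected_component_subset)

section \<open>The holonomy group as the identity component of the isometry group\<close>

context n8_connection
begin

text \<open>Transport up to time t gives a path of matrices from the identity to \<open>B\<close>.
  Metric compatibility makes the derivative of the transported inner products vanish, so the whole
  path consists of isometries.\<close>

lemma transport_along_path: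
  assumes "bilinear g" and compat: "\<And>x y z. g (D x y) z + g y (D x z) = 0"
    and "transport_along n8 g c B"
  shows "\<exists>P :: real \<Rightarrow> real ^ 8 ^ 8. continuous_on {0..1} P \<and> P 0 = mat 1
      \<and> P 1 = B \<and>
    (\<forall>t\<in>{0..1}. \<forall>x y. g (P t *v x) (P t *v y) = g x y)"
proof -
  obtain u V where V: "\<And>v. V v 0 = v" "\<And>v. V v 1 = B *v v"
    "\<And>v t. t \<in> {0..1} \<Longrightarrow> (V v has_vector_derivative
        - D (u t) (V v t)) (at t within {0..1})"
    using assms(3) unfolding transport_along_def levi_civita by metis
  \<comment> \<open>The columns are chosen solutions starting at the basis vectors. By linearity of
    the transport equation their combinations solve it for every initial vector, so uniqueness of
    solutions does not enter.\<close>
  define P where "P t = (\<chi> i j. V (axis j 1) t $ i)" for t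
  have P_mult: "P t *v x = (\<Sum>j\<in>UNIV. x $ j *\<^sub>R V (axis j 1) t)" for t x
    by (simp add: P_def matrix_vector_mult_def vec_eq_iff mult.commute)
  have deriv: "((\<lambda>t. P t *v x) has_vector_derivative
      - D (u t) (P t *v x)) (at t within {0..1})"
    if "t \<in> {0..1}" for t x
  proof -
    have "((\<lambda>t. P t *v x) has_vector_derivative
        (\<Sum>j\<in>UNIV. x $ j *\<^sub>R - D (u t) (V (axis j 1) t))) (at t within {0..1})"
      unfolding P_mult
      by (intro has_vector_derivative_sum bounded_linear.has_vector_derivative[OF
          bounded_linear_scaleR_right] V that)
    also have "(\<Sum>j\<in>UNIV. x $ j *\<^sub>R - D (u t) (V (axis j 1) t)) =
        - D (u t) (P t *v x)"
    proof -
      have lin: "linear (D (u t))"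
        using bilinear by (simp add: bilinear_def)
      show ?thesis
        unfolding P_mult linear_sum[OF lin] linear_scale[OF lin] by (simp add: sum_negf)
    qed
    finally show ?thesis .
  qed
  have "continuous_on {0..1} (\<lambda>t. V (axis j 1) t)" for j
    using V(3) has_vector_derivative_continuous continuous_on_eq_continuous_within by blast
  then have "continuous_on {0..1} P"
    unfolding P_def[abs_def] by (intro continuous_intros) auto
  moreover have "P 0 = mat 1"
    by (simp add: P_def V vec_eq_iff mat_def axis_def)
  moreover have "P 1 = B"
    by (simp add: P_def V vec_eq_iff matrix_vector_mul_component inner_axis)
  moreover have "g (P t *v x) (P t *v y) = g x y" if "t \<in> {0..1}" for t x y
  proof -
    have "bounded_bilinear g"
      using assms(1) bilinear_conv_bounded_bilinear by blast
    note gd = bounded_bilinear.has_vector_derivative[OF this deriv deriv]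
    have "((\<lambda>t. g (P t *v x) (P t *v y)) has_vector_derivative 0) (at t within {0..1})"
      if "t \<in> {0..1}" for t
    proof -
      have "g (P t *v x) (- D (u t) (P t *v y)) + g (- D (u t) (P t *v x)) (P t *v y) = 0"
        using compat[of "u t" "P t *v x" "P t *v y"]
        by (simp add: bilinear_lneg[OF assms(1)] bilinear_rneg[OF assms(1)])
      with gd[OF that that, of x y] show ?thesis
        by (simp only:)
    qed
    from has_vector_derivative_zero_imp_eq[of "{0..1}", OF this, of t 0] that show ?thesis
      by (simp add: \<open>P 0 = mat 1\<close>)
  qed
  ultimately show ?thesis
    by (intro exI[of _ P]) simp
qed

text \<open>Conjugation by the frame \<open>F\<close> turns isometries of \<open>g\<close> into
  isometries of the diagonal form. The forward inclusion is the existence of connecting paths of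
  isometries. For the converse, a neighbourhood of the identity inside the holonomy group is spread
  over the connected group \<open>SO_plus p q\<close>.\<close>

lemma holonomy_is_SO_plusI:
  assumes "bilinear g" and compat: "\<And>x y z. g (D x y) z + g y (D x z) = 0"
    and pq: "p + q = 8"
    and frame: "\<And>x y. g (F *v x) (F *v y) = x \<bullet> (diag_pq p q *v y)"
    and skew: "\<And>Z. (\<And>x y. g (Z *v x) y
        + g x (Z *v y) = 0) \<Longrightarrow> Z \<in> tangent (holonomy_group n8 g)"
  shows "holonomy_is_SO_plus n8 g p q"
proof -
  let ?\<eta> = "diag_pq p q" and ?H = "holonomy_group n8 g"
  interpret H: matrix_monoid ?H
    by (rule matrix_monoid_holonomy_group)
  have "inj ((*v) F)"
  proof (rule injI)
    fix x y assume "F *v x = F *v y"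
    then have "z \<bullet> (?\<eta> *v x) = z \<bullet> (?\<eta> *v y)" for z
      using frame[of z x] frame[of z y] by simp
    then have "?\<eta> *v x = ?\<eta> *v y"
      by (metis vector_eq_ldot)
    then show "x = y"
      using diag_pq_square[OF pq] by (metis matrix_vector_mul_assoc matrix_vector_mul_lid)
  qed
  then have F: "invertible F"
    using matrix_left_invertible_injective invertible_left_inverse by blast
  define F' where "F' = matrix_inv F"
  have F': "F ** F' = mat 1" "F' ** F = mat 1"
    using someI_ex[OF F[unfolded invertible_def]] unfolding F'_def matrix_inv_def by blast+
  have F'F: "A ** F ** F' = A" "A ** F' ** F = A" for A
    by (simp_all add: F' flip: matrix_mul_assoc)
  \<comment> \<open>The Gram matrix of \<open>g\<close> in the standard basis, recovered from the
    orthonormal frame.\<close>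
  define G where "G = transpose F' ** ?\<eta> ** F'"
  have g: "g x y = x \<bullet> (G *v y)" for x y
    using frame[of "F' *v x" "F' *v y"]
    by (simp add: G_def F' inner_transpose_matrix_vector matrix_vector_mul_assoc del:
        transpose_matrix_vector
        flip: matrix_mul_assoc)
      (simp add: inner_transpose_matrix_vector del: transpose_matrix_vector flip:
          matrix_vector_mul_assoc)
  have GF: "transpose F ** G ** F = ?\<eta>"
    by (simp add: G_def matrix_mul_assoc F'F flip: matrix_transpose_mul) (simp add: F' flip:
        matrix_mul_assoc)
  have symG: "transpose G = G"
    by (simp add: G_def matrix_transpose_mul diag_pq_symmetric matrix_mul_assoc)
  have "G ** (F ** ?\<eta> ** transpose F) = transpose F' ** (?\<eta> ** ?\<eta>) ** transpose F"
    by (simp add: G_def matrix_mul_assoc F'F)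
  also have "\<dots> = transpose (F ** F')"
    by (simp add: diag_pq_square[OF pq] matrix_transpose_mul)
  finally have invG: "invertible G"
    unfolding F' transpose_mat invertible_right_inverse by blast
  have g_iff: "(\<forall>x y. g (A *v x) (A *v y) = g x y)
      \<longleftrightarrow> transpose A ** G ** A = G" for A
  proof -
    have "g (A *v x) (A *v y) = x \<bullet> ((transpose A ** G ** A) *v y)" for x y
      by (simp only: g inner_transpose_matrix_vector flip: matrix_vector_mul_assoc)
    then show ?thesis
      unfolding g matrix_eq by (metis vector_eq_ldot)
  qed
  have conj_iff: "transpose (F' ** A ** F) ** ?\<eta> ** (F' ** A ** F) = ?\<eta>
      \<longleftrightarrow> transpose A ** G ** A = G" for A
  proof -
    have "transpose (F' ** A ** F) ** ?\<eta> ** (F' ** A ** F) = transpose F ** (transpose A ** G **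
        A) ** F"
      by (simp add: G_def matrix_transpose_mul matrix_mul_assoc)
    moreover have "transpose F ** X ** F = transpose F ** Y ** F
        \<longleftrightarrow> X = Y" for X Y
    proof
      assume eq: "transpose F ** X ** F = transpose F ** Y ** F"
      have "transpose F' ** (transpose F ** Z ** F) ** F' = transpose (F ** F') ** Z ** (F ** F')"
          for Z
        by (simp only: matrix_transpose_mul matrix_mul_assoc)
      with eq show "X = Y"
        by (metis F'(1) matrix_mul_lid matrix_mul_rid transpose_mat)
    qed simp
    ultimately show ?thesis
      using GF by metis
  qed
  \<comment> \<open>Stated for arbitrary end points, since the initial pieces of a loop are open
    paths.\<close>
  have into: "F' ** A ** F \<in> SO_plus p q" if "transport n8 g r s A" for r s A
    using that
  proof (induction rule: transport.induct)
    case refl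
    then show ?case
      using one_mem_SO by (simp add: F' SO_plus_def)
  next
    case (step x y A c B z)
    obtain P :: "real \<Rightarrow> real ^ 8 ^ 8" where P: "continuous_on {0..1} P" "P 0 = mat 1" "P 1 = B"
      "\<And>t x y. t \<in> {0..1} \<Longrightarrow> g (P t *v x) (P t *v y) = g x y"
      using transport_along_path[OF assms(1) compat step.hyps(2)] by blast
    define C where "C t = F' ** P t ** F" for t
    have contC: "continuous_on {0..1} C"
      unfolding C_def[abs_def] by (intro continuous_intros P)
    have C\<eta>: "transpose (C t) ** ?\<eta> ** C t = ?\<eta>" if "t \<in> {0..1}" for t
      using P(4)[OF that] unfolding C_def conj_iff g_iff[symmetric] by blast
    \<comment> \<open>Isometries have determinant 1 or -1. Along the path the determinants form a
      connected finite set containing 1, hence only 1 occurs.\<close>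
    have "det (C t) = 1 \<or> det (C t) = -1" if "t \<in> {0..1}" for t
    proof -
      have "det (C t) * det (C t) = 1"
        using arg_cong[OF C\<eta>[OF that], of det] det_diag_pq[OF pq] by (simp add: det_mul)
      then show ?thesis
        by (simp add: square_eq_1_iff)
    qed
    then have "(\<lambda>t. det (C t)) ` {0..1} \<subseteq> {1, -1}"
      by blast
    then have "finite ((\<lambda>t. det (C t)) ` {0..1})"
      by (rule finite_subset) simp
    moreover have "connected ((\<lambda>t. det (C t)) ` {0..1})"
      by (intro connected_continuous_image continuous_intros contC) auto
    ultimately have "(\<lambda>t. det (C t)) ` {0..1} = {} \<or> (\<exists>d. (\<lambda>t. det (C t)) ` {0..1} = {d})"
      using connected_finite_iff_sing by blast
    moreover have "1 \<in> (\<lambda>t. det (C t)) ` {0..1}"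
      by (rule image_eqI[of _ _ 0]) (simp_all add: C_def P F')
    ultimately have "(\<lambda>t. det (C t)) ` {0..1} = {1}"
      by (metis empty_iff singletonD)
    then have "det (C t) = 1" if "t \<in> {0..1}" for t
      using that by blast
    with C\<eta> have C_SO: "C t \<in> SO p q" if "t \<in> {0..1}" for t
      using that by (simp add: SO_def)
    \<comment> \<open>The path of the last piece, multiplied on the right by \<open>?A\<close>,
      joins \<open>?A\<close> to the conjugate of \<open>B ** A\<close> without leaving
      \<open>SO p q\<close>; so the component of the identity is never left.\<close>
    let ?A = "F' ** A ** F"
    let ?T = "(\<lambda>t. C t ** ?A) ` {0..1}"
    have A_SO: "?A \<in> SO p q"
      using step.IH SO_plus_subset_SO by blast
    have "connected ?T"
      by (intro connected_continuous_image continuous_intros contC) auto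
    moreover have "?T \<subseteq> SO p q"
      using SO_mult[OF C_SO A_SO] by blast
    moreover have "?A \<in> ?T"
      by (rule image_eqI[of _ _ 0]) (auto simp: C_def P F')
    moreover have "F' ** (B ** A) ** F \<in> ?T"
      by (rule image_eqI[of _ _ 1]) (auto simp: C_def P matrix_mul_assoc F'F)
    ultimately have "connected_component (SO p q) ?A (F' ** (B ** A) ** F)"
      unfolding connected_component_def by blast
    then show ?case
      using step.IH connected_component_trans unfolding SO_plus_def by blast
  qed
  have onto: "F ** A ** F' \<in> ?H" if "A \<in> SO_plus p q" for A
  proof -
    obtain U where U: "open U" "mat 1 \<in> U" "\<And>A. A \<in> U \<Longrightarrow> transpose A ** G ** A = G \<Longrightarrow> A \<in> ?H"
    proof -
      have "transpose A ** G ** A = G" if "A \<in> ?H" for A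
        using into[of 0 0 A] that SO_plus_subset_SO conj_iff
        unfolding holonomy_group_def SO_def by blast
      moreover have "Z \<in> tangent ?H" if "transpose Z ** G + G ** Z = 0" for Z
      proof (rule skew)
        fix x y
        have "g (Z *v x) y + g x (Z *v y) = x \<bullet> ((transpose Z ** G + G ** Z) *v y)"
          by (simp only: g inner_transpose_matrix_vector matrix_vector_mult_add_rdistrib
              inner_add_right
              flip: matrix_vector_mul_assoc)
        then show "g (Z *v x) y + g x (Z *v y) = 0"
          using that by simp
      qed
      ultimately show ?thesis
        using H.isometries_near_one_mem[OF symG invG] that by blast
    qed
    have SO\<eta>: "transpose X ** ?\<eta> ** X = ?\<eta>" if "X \<in> SO_plus p q" for X
      using that SO_plus_subset_SO unfolding SO_def by blast
    \<comment> \<open>For X in SO(p,q) the inverse is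
      \<open>?\<eta> ** transpose X ** ?\<eta>\<close>, so \<open>Q (X, Y)\<close> is the conjugate
      of X^-1 Y. Near (a, a) it is close to the identity and hence in the holonomy group. Then y = x
      (x^-1 y) carries membership from x to y, using products only.\<close>
    define Q where "Q = (\<lambda>(X, Y). F ** (?\<eta> ** transpose X ** ?\<eta> ** Y) ** F')"
    have "connected (SO_plus p q)"
      by (simp add: SO_plus_def)
    moreover have "mat 1 \<in> SO_plus p q"
      using one_mem_SO by (simp add: SO_plus_def)
    moreover have "F ** mat 1 ** F' \<in> ?H"
      by (simp add: F' H.one_mem)
    ultimately show ?thesis
    proof (rule connected_induction_simple[OF _ _ that,
        where P = "\<lambda>A. F ** A ** F' \<in> ?H"])
      fix a assume a: "a \<in> SO_plus p q"
      have inv: "?\<eta> ** transpose X ** ?\<eta> ** X = mat 1" "X ** (?\<eta> ** transpose X ** ?\<eta>) = mat 1"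
        if "X \<in> SO_plus p q" for X
      proof -
        show *: "?\<eta> ** transpose X ** ?\<eta> ** X = mat 1"
          using SO\<eta>[OF that] diag_pq_square[OF pq] by (simp flip: matrix_mul_assoc)
        then show "X ** (?\<eta> ** transpose X ** ?\<eta>) = mat 1"
          using matrix_left_right_inverse by blast
      qed
      have "continuous_on UNIV Q"
        unfolding Q_def case_prod_unfold by (intro continuous_intros)
      then have "open (Q -` U)"
        using U(1) open_vimage by blast
      moreover have "(a, a) \<in> Q -` U"
        using inv[OF a] U(2) by (simp add: Q_def F')
      ultimately obtain V W where VW: "open V" "open W" "(a,
          a) \<in> V \<times> W" "V \<times> W \<subseteq> Q -` U"
        by (rule open_prod_elim)
      let ?T = "SO_plus p q \<inter> (V \<inter> W)"
      have "F ** y ** F' \<in> ?H" if x: "x \<in> ?T" and y: "y \<in> ?T" and xH: "F ** x ** F' \<in> ?H" for x y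
      proof -
        have "Q (x, y) \<in> U"
          using x y VW(4) by auto
        moreover have "transpose (Q (x, y)) ** G ** Q (x, y) = G"
        proof -
          define Y where "Y = ?\<eta> ** transpose x ** ?\<eta> ** y"
          have "transpose Y ** ?\<eta> ** Y = transpose y ** ?\<eta> ** (x ** (?\<eta> ** ?\<eta>) ** (?\<eta> ** transpose
              x ** ?\<eta>)) ** y"
            by (simp add: Y_def matrix_transpose_mul diag_pq_symmetric matrix_mul_assoc)
          also have "\<dots> = transpose y ** ?\<eta> ** y"
            using inv x by (simp add: diag_pq_square[OF pq])
          also have "\<dots> = ?\<eta>"
            using SO\<eta> y by blast
          finally show ?thesis
            unfolding conj_iff[symmetric] by (simp add: Q_def Y_def matrix_mul_assoc F' F'F)
        qed
        ultimately have "Q (x, y) \<in> ?H"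
          by (rule U(3))
        with xH have "(F ** x ** F') ** Q (x, y) \<in> ?H"
          by (rule H.mult_mem)
        also have "(F ** x ** F') ** Q (x,
            y) = F ** (x ** (?\<eta> ** transpose x ** ?\<eta>)) ** y ** F'"
          by (simp add: Q_def matrix_mul_assoc F'F)
        also have "\<dots> = F ** y ** F'"
          using inv x by simp
        finally show ?thesis .
      qed
      moreover have "openin (top_of_set (SO_plus p q)) ?T"
        using VW by (auto intro: openin_open_Int)
      ultimately show "\<exists>T. openin (top_of_set (SO_plus p q)) T \<and> a \<in> T \<and>
          (\<forall>x\<in>T. \<forall>y\<in>T. F ** x ** F' \<in> ?H \<longrightarrow> F ** y ** F' \<in> ?H)"
        using a VW(3) by (intro exI[of _ ?T]) blast
    qed
  qed
  have "?H = {F ** A ** F' | A. A \<in> SO_plus p q}"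
  proof (intro set_eqI iffI)
    fix A assume "A \<in> ?H"
    then have "F' ** A ** F \<in> SO_plus p q"
      using into by (simp add: holonomy_group_def)
    moreover have "A = F ** (F' ** A ** F) ** F'"
      by (simp add: matrix_mul_assoc F' F'F)
    ultimately show "A \<in> {F ** A ** F' | A. A \<in> SO_plus p q}"
      by blast
  qed (use onto in auto)
  then show ?thesis
    unfolding holonomy_is_SO_plus_def F'_def using F frame by blast
qed

end

section \<open>Recognizing the Levi-Civita connection and Einstein metrics\<close>

text \<open>The difference \<open>E\<close> of two such connections is symmetric in its arguments by
  the torsion condition and skew for the metric by compatibility. A trilinear form symmetric in the
  first two slots and skew in the last two vanishes.\<close>

lemma levi_civita_eqI:
  assumes g: "pseudo_metric g" and D: "bilinear D" "\<And>x y. D x y - D y x = b x y"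
    and compat: "\<And>x y z. g (D x y) z + g y (D x z) = 0"
  shows "levi_civita b g = D"
  unfolding levi_civita_def
proof (rule the_equality)
  fix D' assume D': "bilinear D' \<and> (\<forall>x y. D' x y - D' y x = b x y) \<and>
    (\<forall>x y z. g (D' x y) z + g y (D' x z) = 0)"
  have bil: "bilinear g" and sym: "\<And>x y. g x y = g y x"
    and nondeg: "\<And>x. (\<And>y. g x y = 0) \<Longrightarrow> x = 0"
    using g unfolding pseudo_metric_def by blast+
  define E where "E x y = D' x y - D x y" for x y
  have E_sym: "E x y = E y x" for x y
  proof -
    have "D' x y - D' y x = D x y - D y x"
      using D' D(2) by simp
    then show ?thesis
      by (simp add: E_def algebra_simps)
  qed
  have "g (D' x y) z + g y (D' x z) = 0" for x y z
    using D' by blast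
  then have E_skew: "g (E x y) z = - g y (E x z)" for x y z
    using compat[of x y z] by (simp add: E_def bilinear_lsub[OF bil] bilinear_rsub[OF bil]
        algebra_simps)
  \<comment> \<open>Alternating the two symmetries three times returns the form with the opposite
    sign.\<close>
  have "g (E x y) z = 0" for x y z
    using E_skew[of x y z] E_skew[of z y x] E_skew[of y z x]
    by (simp add: E_sym[of x] E_sym[of z y] sym[of x] sym[of y] sym[of z])
  then have "E x y = 0" for x y
    using nondeg by blast
  then show "D' = D"
    by (simp add: E_def fun_eq_iff)
qed (use assms in auto)

lemma ricci_operator_einstein:
  assumes g: "pseudo_metric g" and ric: "\<And>y z. ricci_tensor b g y z = l * g y z"
  shows "ricci_operator b g = (\<lambda>y. l *\<^sub>R y)"
proof
  fix y
  have bil: "bilinear g" and nondeg: "\<And>x. (\<And>y. g x y = 0) \<Longrightarrow> x = 0"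
    using g unfolding pseudo_metric_def by blast+
  show "ricci_operator b g y = l *\<^sub>R y"
    unfolding ricci_operator_def
  proof (rule the_equality)
    fix v assume "\<forall>z. g v z = ricci_tensor b g y z"
    then have "v - l *\<^sub>R y = 0"
      by (intro nondeg) (simp add: ric bilinear_lsub[OF bil] bilinear_lmul[OF bil])
    then show "v = l *\<^sub>R y" by simp
  qed (simp add: ric bilinear_lmul[OF bil])
qed

lemma einstein_scalar_curvature:
  fixes g :: "real ^ 'n \<Rightarrow> real ^ 'n \<Rightarrow> real"
  assumes "pseudo_metric g" and "\<And>y z. ricci_tensor b g y z = l * g y z"
  shows "einstein b g" and "scalar_curvature b g = of_nat CARD('n) * l"
proof -
  note ric = ricci_operator_einstein[OF assms]
  show "einstein b g"
    unfolding einstein_def ric by blast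
  show "scalar_curvature b g = of_nat CARD('n) * l"
    by (simp add: scalar_curvature_def ric matrix_scaleR trace_def mat_def)
qed

section \<open>Pairing skew endomorphisms with bivectors\<close>

text \<open>A bivector is stored as its array of coefficients \<open>h\<close> and evaluated on
  bilinear forms. Curvature endomorphisms lowered by the metric can then be substituted as
  combinations of \<open>wedge\<close>.\<close>

definition pairing :: "('n \<Rightarrow> 'n \<Rightarrow> real) \<Rightarrow> (real ^ 'n \<Rightarrow> real ^ 'n \<Rightarrow> real) \<Rightarrow> real" where
  "pairing h B = (\<Sum>i\<in>UNIV. \<Sum>j\<in>UNIV. h i j * B (axis i 1) (axis j 1))"

lemma pairing_simps:
  "pairing h (\<lambda>w z. 0) = 0"
  "pairing h (\<lambda>w z. B w z + C w z) = pairing h B + pairing h C"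
  "pairing h (\<lambda>w z. B w z - C w z) = pairing h B - pairing h C"
  "pairing h (\<lambda>w z. - B w z) = - pairing h B"
  "pairing h (\<lambda>w z. c * B w z) = c * pairing h B"
proof -
  show "pairing h (\<lambda>w z. 0) = 0"
    by (simp add: pairing_def)
  show "pairing h (\<lambda>w z. B w z + C w z) = pairing h B + pairing h C"
    unfolding pairing_def by (simp only: distrib_left sum.distrib)
  show "pairing h (\<lambda>w z. B w z - C w z) = pairing h B - pairing h C"
    unfolding pairing_def by (simp only: right_diff_distrib sum_subtractf)
  show "pairing h (\<lambda>w z. - B w z) = - pairing h B"
    unfolding pairing_def by (simp only: mult_minus_right sum_negf)
  show "pairing h (\<lambda>w z. c * B w z) = c * pairing h B"
    unfolding pairing_def by (simp only: sum_distrib_left mult.left_commute[of _ c])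
qed

lemma pairing_wedge:
  "pairing h (wedge k l) = h k l - h l k"
proof -
  have delta: "(\<Sum>i\<in>UNIV. \<Sum>j\<in>UNIV. if i = a
      \<and> j = b then h i j else 0) = h a b" for a b :: 8
  proof -
    have "(\<Sum>j\<in>UNIV. if i = a
        \<and> j = b then h i j else 0) = (if i = a then h i b else 0)" for i
      by (cases "i = a") simp_all
    then show ?thesis by simp
  qed
  have "h i j * wedge k l (axis i 1) (axis j 1) =
      (if i = k \<and> j = l then h i j else 0) - (if i = l \<and> j = k then h i j else 0)" for i j
  proof -
    have axis: "axis i 1 $ k = (if i = k then 1 else 0 :: real)" for i k :: 8
      by (auto simp: axis_def)
    show ?thesis
      unfolding wedge_def axis
      by (cases "i = k"; cases "i = l"; cases "j = k"; cases "j = l") (simp_all only: if_True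
          if_False simp_thms,
          simp_all)
  qed
  then have "pairing h (wedge k l) = (\<Sum>i\<in>UNIV. \<Sum>j\<in>UNIV.
      (if i = k \<and> j = l then h i j else 0) - (if i = l \<and> j = k then h i j else 0))"
    unfolding pairing_def by simp
  then show ?thesis
    by (simp add: sum_subtractf delta)
qed

text \<open>A linear functional on the skew endomorphisms is the pairing with a bivector, so the
  curvature endomorphisms exhaust the skew ones once no nonzero bivector is orthogonal to all of them.\<close>

lemma skew_mem_if_pairing_nondegenerate:
  fixes g :: "real ^ 'n \<Rightarrow> real ^ 'n \<Rightarrow> real" and S :: "(real ^ 'n ^ 'n) set"
  assumes g: "pseudo_metric g" and "subspace S"
    and nondeg: "\<And>h. (\<And>i j. h j i = - h i j) \<Longrightarrow>
      (\<And>Z. Z \<in> S \<Longrightarrow> (\<And>x y. g (Z *v x) y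
          + g x (Z *v y) = 0) \<Longrightarrow> pairing h (\<lambda>w z. g w (Z *v z)) = 0) \<Longrightarrow> h = (\<lambda>_ _. 0)"
    and Z: "\<And>x y. g (Z *v x) y + g x (Z *v y) = 0"
  shows "Z \<in> S"
proof (rule subspace_memI_orthogonal[OF \<open>subspace S\<close>])
  fix a assume a: "\<And>Y. Y \<in> S \<Longrightarrow> a \<bullet> Y = 0"
  have bil: "bilinear g" and sym: "\<And>x y. g x y = g y x"
    and g0: "\<And>x. (\<And>y. g x y = 0) \<Longrightarrow> x = 0"
    using g unfolding pseudo_metric_def by blast+
  define G where "G = (\<chi> i j. g (axis i 1) (axis j 1))"
  have Gv: "(G *v z) $ i = g (axis i 1) z" for z i
  proof -
    have lin: "linear (g (axis i 1))"
      using bil by (simp add: bilinear_def)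
    have "g (axis i 1) z = g (axis i 1) (\<Sum>j\<in>UNIV. z $ j *\<^sub>R axis j 1)"
      by (simp add: basis_expansion scalar_mult_eq_scaleR[symmetric])
    also have "\<dots> = (G *v z) $ i"
      unfolding linear_sum[OF lin] linear_scale[OF lin] by (simp add: G_def matrix_vector_mult_def
          mult.commute)
    finally show ?thesis by simp
  qed
  have gG: "g w z = w \<bullet> (G *v z)" for w z
  proof -
    have lin: "linear (\<lambda>w. g w z)"
      using bil by (simp add: bilinear_def)
    have "g w z = g (\<Sum>i\<in>UNIV. w $ i *\<^sub>R axis i 1) z"
      by (simp add: basis_expansion scalar_mult_eq_scaleR[symmetric])
    also have "\<dots> = w \<bullet> (G *v z)"
      unfolding linear_sum[OF lin] linear_scale[OF lin] by (simp add: Gv inner_vec_def)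
    finally show ?thesis .
  qed
  have "inj ((*v) G)"
  proof (rule injI)
    fix x y assume "G *v x = G *v y"
    then have "g (x - y) w = 0" for w
      by (subst sym) (simp add: gG matrix_vector_mult_diff_distrib)
    then show "x = y"
      using g0[of "x - y"] by simp
  qed
  then obtain G' where G': "G' ** G = mat 1"
    using matrix_left_invertible_injective by blast
  \<comment> \<open>Writing \<open>Y\<close> as \<open>G'\<close> times the lowered form ?B of
    \<open>Y\<close> moves \<open>G'\<close> onto \<open>a\<close>: \<open>h0\<close> is
    \<open>transpose G' ** a\<close>. As the lowered form is antisymmetric, only the antisymmetric
    part \<open>h\<close> of \<open>h0\<close> counts.\<close>
  define h0 where "h0 i j = (\<Sum>m\<in>UNIV. a $ m $ j * G' $ m $ i)" for i j
  define h where "h i j = (h0 i j - h0 j i) / 2" for i j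
  have a_pairing: "a \<bullet> Y = pairing h (\<lambda>w z. g w (Y *v z))"
    if Y: "\<And>x y. g (Y *v x) y + g x (Y *v y) = 0" for Y
  proof -
    let ?B = "\<lambda>i j. g (axis i 1) (Y *v axis j 1)"
    have B: "?B j i = - ?B i j" for i j
      using Y[of "axis i 1" "axis j 1"] sym[of "Y *v axis i 1"] by simp
    have "Y $ m $ j = (\<Sum>i\<in>UNIV. G' $ m $ i * ?B i j)" for m j
    proof -
      have "Y $ m $ j = (Y *v axis j 1) $ m"
        by (simp add: matrix_vector_mul_component inner_axis)
      also have "\<dots> = ((G' ** G) *v (Y *v axis j 1)) $ m"
        by (simp only: G' matrix_vector_mul_lid)
      also have "\<dots> = (G' *v (G *v (Y *v axis j 1))) $ m"
        by (simp only: matrix_vector_mul_assoc[symmetric])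
      finally show ?thesis
        by (simp only: matrix_vector_mult_def[of G'] vec_lambda_beta Gv)
    qed
    then have "a \<bullet> Y = (\<Sum>m\<in>UNIV. \<Sum>j\<in>UNIV. \<Sum>i\<in>UNIV. a $ m $ j * G' $ m $ i * ?B i j)"
      by (simp add: inner_vec_def sum_distrib_left mult_ac)
    also have "\<dots> = (\<Sum>m\<in>UNIV. \<Sum>i\<in>UNIV. \<Sum>j\<in>UNIV. a $ m $ j * G' $ m $ i * ?B i j)"
      by (rule sum.cong[OF HOL.refl], rule sum.swap)
    also have "\<dots> = (\<Sum>i\<in>UNIV. \<Sum>m\<in>UNIV. \<Sum>j\<in>UNIV. a $ m $ j * G' $ m $ i * ?B i j)"
      by (rule sum.swap)
    also have "\<dots> = (\<Sum>i\<in>UNIV. \<Sum>j\<in>UNIV. \<Sum>m\<in>UNIV. a $ m $ j * G' $ m $ i * ?B i j)"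
      by (rule sum.cong[OF HOL.refl], rule sum.swap)
    also have "\<dots> = (\<Sum>i\<in>UNIV. \<Sum>j\<in>UNIV. h0 i j * ?B i j)"
      by (simp add: h0_def sum_distrib_right)
    also have "\<dots> = pairing h (\<lambda>w z. g w (Y *v z))"
    proof -
      have "(\<Sum>i\<in>UNIV. \<Sum>j\<in>UNIV. h0 j i * ?B i j) = (\<Sum>i\<in>UNIV. \<Sum>j\<in>UNIV. h0 i j * ?B j i)"
        by (rule sum.swap)
      also have "\<dots> = (\<Sum>i\<in>UNIV. \<Sum>j\<in>UNIV. - (h0 i j * ?B i j))"
        by (intro sum.cong HOL.refl) (metis B mult_minus_right)
      finally have "(\<Sum>i\<in>UNIV. \<Sum>j\<in>UNIV. h0 j i * ?B i j) =
          - (\<Sum>i\<in>UNIV. \<Sum>j\<in>UNIV. h0 i j * ?B i j)"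
        by (simp only: sum_negf)
      moreover have "pairing h (\<lambda>w z. g w (Y *v z))
          = (\<Sum>i\<in>UNIV. \<Sum>j\<in>UNIV. (1/2) * (h0 i j * ?B i j - h0 j i * ?B i j))"
        unfolding pairing_def h_def by (intro sum.cong HOL.refl) (simp add: field_simps)
      ultimately show ?thesis
        by (simp only: sum_distrib_left[symmetric] sum_subtractf) simp
    qed
    finally show ?thesis .
  qed
  have "h = (\<lambda>_ _. 0)"
  proof (rule nondeg)
    show "h j i = - h i j" for i j
      by (simp add: h_def field_simps)
    show "pairing h (\<lambda>w z. g w (Y *v z)) = 0"
      if "Y \<in> S" "\<And>x y. g (Y *v x) y + g x (Y *v y) = 0" for Y
      using a_pairing[OF that(2)] a[OF that(1)] by simp
  qed
  then show "a \<bullet> Z = 0"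
    using a_pairing[OF Z] by (simp add: pairing_def)
qed

text \<open>Curvature endomorphisms are skew and tangent to the holonomy group, so a bivector
  orthogonal to all skew tangent vectors is in particular orthogonal to them; that is enough to make
  it zero.\<close>

lemma (in n8_connection) skew_mem_tangent:
  assumes g: "pseudo_metric g" and compat: "\<And>x y z. g (D x y) z + g y (D x z) = 0"
    and nondeg: "\<And>h. (\<And>i j. h j i = - h i j) \<Longrightarrow>
      (\<And>x y. pairing h (\<lambda>w z. g w (curvature n8 g x y z)) = 0) \<Longrightarrow> h = (\<lambda>_ _. 0)"
    and Z: "\<And>x y. g (Z *v x) y + g x (Z *v y) = 0"
  shows "Z \<in> tangent (holonomy_group n8 g)"
proof (rule skew_mem_if_pairing_nondegenerate[OF g _ _ Z])
  interpret H: matrix_monoid "holonomy_group n8 g"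
    by (rule matrix_monoid_holonomy_group)
  show "subspace (tangent (holonomy_group n8 g))"
    by (rule H.subspace_tangent)
  fix h
  assume anti: "\<And>i j. h j i = - h i j"
    and h: "\<And>Z. Z \<in> tangent (holonomy_group n8 g) \<Longrightarrow> (\<And>x y. g (Z *v x) y
        + g x (Z *v y) = 0) \<Longrightarrow>
      pairing h (\<lambda>w z. g w (Z *v z)) = 0"
  have bil: "bilinear g"
    using g by (simp add: pseudo_metric_def)
  have "pairing h (\<lambda>w z. g w (curvature n8 g x y z)) = 0" for x y
  proof -
    let ?Z = "matrix (curvature n8 g x y)"
    \<comment> \<open>Two uses of compatibility move a product of two connection operators across
      the metric in reversed order, and a fifth handles the bracket term.\<close>
    have "g (?Z *v u) v + g u (?Z *v v) = 0" for u v
      using compat[of x "D y u" v] compat[of y u "D x v"] compat[of y "D x u" v] compat[of x u "D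
          y v"]
        compat[of "n8 x y" u v]
      by (simp add: matrix_curvature_works curvature_def Let_def levi_civita bilinear_lsub[OF bil]
          bilinear_rsub[OF bil])
    from h[OF curvature_tangent this] show ?thesis
      by (simp add: matrix_curvature_works)
  qed
  with anti show "h = (\<lambda>_ _. 0)"
    by (rule nondeg)
qed

section \<open>The Levi-Civita connections of the four metrics\<close>

lemma bilinear_metric_i: "bilinear (metric_i s)"
  unfolding bilinear_def by (auto intro!: linearI simp: metric_i_def tens_def field_simps)

lemma pseudo_metric_i:
  assumes "s \<in> {1, -1}"
  shows "pseudo_metric (metric_i s)"
  unfolding pseudo_metric_def
proof (intro conjI allI impI)
  show "metric_i s x y = metric_i s y x" for x y
    by (simp add: metric_i_def tens_def mult.commute add.commute)
  fix x assume *: "\<forall>y. metric_i s x y = 0"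
  have "x $ 1 = 0" "x $ 2 = 0" "x $ 3 = 0" "x $ 4 = 0" "x $ 5 = 0" "x $ 6 = 0" "x $ 7 = 0" "x $ 8
      = 0"
    using *[rule_format, of "axis 1 1"] *[rule_format, of "axis 2 1"] *[rule_format, of "axis 3 1"]
      *[rule_format, of "axis 4 1"] *[rule_format, of "axis 5 1"] *[rule_format, of "axis 6 1"]
      *[rule_format, of "axis 7 1"] *[rule_format, of "axis 8 1"] assms
    by (auto simp: metric_i_def tens_def axis_def)
  then show "x = 0"
    by (intro vec8_eqI) simp_all
qed (rule bilinear_metric_i)

text \<open>Koszul's formula makes the connection half the bracket plus a symmetric part.\<close>

definition conn_i :: "real \<Rightarrow> real ^ 8 \<Rightarrow> real ^ 8 \<Rightarrow> real ^ 8" where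
  "conn_i s x y = (1/2) *\<^sub>R n8 x y + vector [
     7/6 * odot 2 5 x y + 49/15 * s * odot 3 8 x y + 7/6 * s * odot 4 6 x y
         - 49/15 * s * odot 6 7 x y,
     - 7/6 * odot 1 5 x y - 7/6 * s * odot 3 6 x y + 49/15 * s * odot 4 7 x y
         - 49/15 * s * odot 6 8 x y,
     - 49/15 * odot 1 8 x y + 7/6 * odot 2 6 x y + 7/6 * s * odot 4 5 x y - 49/15 * odot 5 7 x y,
     - 7/6 * odot 1 6 x y - 49/15 * odot 2 7 x y - 7/6 * s * odot 3 5 x y - 49/15 * odot 5 8 x y,
     - 7/5 * s * odot 3 7 x y - 7/5 * s * odot 4 8 x y,
     - 7/5 * odot 1 7 x y - 7/5 * odot 2 8 x y,
     0,
     0]"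

lemma conn_i_nth:
  "conn_i s x y $ 1 = 1/2 * n8 x y $ 1 + (7/6 * odot 2 5 x y + 49/15 * s * odot 3 8 x y
      + 7/6 * s * odot 4 6 x y - 49/15 * s * odot 6 7 x y)"
  "conn_i s x y $ 2 = 1/2 * n8 x y $ 2 + (- 7/6 * odot 1 5 x y - 7/6 * s * odot 3 6 x y
      + 49/15 * s * odot 4 7 x y - 49/15 * s * odot 6 8 x y)"
  "conn_i s x y $ 3 = 1/2 * n8 x y $ 3 + (- 49/15 * odot 1 8 x y + 7/6 * odot 2 6 x y
      + 7/6 * s * odot 4 5 x y - 49/15 * odot 5 7 x y)"
  "conn_i s x y $ 4 = 1/2 * n8 x y $ 4 + (- 7/6 * odot 1 6 x y - 49/15 * odot 2 7 x y
      - 7/6 * s * odot 3 5 x y - 49/15 * odot 5 8 x y)"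
  "conn_i s x y $ 5 = 1/2 * n8 x y $ 5 + (- 7/5 * s * odot 3 7 x y - 7/5 * s * odot 4 8 x y)"
  "conn_i s x y $ 6 = 1/2 * n8 x y $ 6 + (- 7/5 * odot 1 7 x y - 7/5 * odot 2 8 x y)"
  "conn_i s x y $ 7 = 1/2 * n8 x y $ 7"
  "conn_i s x y $ 8 = 1/2 * n8 x y $ 8"
  by (simp_all add: conn_i_def vector_def)

lemma bilinear_conn_i: "bilinear (conn_i s)"
  unfolding bilinear_def
  by (auto intro!: linearI vec8_eqI simp: conn_i_nth n8_nth wedge_def odot_def tens_def
      algebra_simps add_divide_distrib diff_divide_distrib)

lemma conn_i_torsion: "conn_i s x y - conn_i s y x = n8 x y"
  by (rule vec8_eqI) (simp_all add: conn_i_nth n8_nth wedge_def odot_def tens_def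
      algebra_simps add_divide_distrib diff_divide_distrib)

lemma conn_i_metric:
  assumes "s \<in> {1, -1}"
  shows "metric_i s (conn_i s x y) z + metric_i s y (conn_i s x z) = 0"
proof -
  have "s = 1 \<or> s = -1" using assms by auto
  then show ?thesis
    by (elim disjE; simp add: metric_i_def conn_i_nth n8_nth wedge_def odot_def tens_def;
        simp add: algebra_simps add_divide_distrib diff_divide_distrib)
qed

lemma levi_civita_i: "s \<in> {1, -1} \<Longrightarrow> levi_civita n8 (metric_i s) = conn_i s"
  by (intro levi_civita_eqI pseudo_metric_i bilinear_conn_i conn_i_torsion conn_i_metric)

lemma bilinear_metric_ii: "bilinear (metric_ii s)"
  unfolding bilinear_def by (auto intro!: linearI simp: metric_ii_def odot_def tens_def field_simps)

lemma pseudo_metric_ii: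
  assumes "s \<in> {1, -1}"
  shows "pseudo_metric (metric_ii s)"
  unfolding pseudo_metric_def
proof (intro conjI allI impI)
  show "metric_ii s x y = metric_ii s y x" for x y
    by (simp add: metric_ii_def odot_def tens_def mult.commute add.commute)
  fix x assume *: "\<forall>y. metric_ii s x y = 0"
  have "x $ 1 = 0" "x $ 2 = 0" "x $ 3 = 0" "x $ 4 = 0" "x $ 5 = 0" "x $ 6 = 0" "x $ 7 = 0" "x $ 8
      = 0"
    using *[rule_format, of "axis 1 1"] *[rule_format, of "axis 2 1"] *[rule_format, of "axis 3 1"]
      *[rule_format, of "axis 4 1"] *[rule_format, of "axis 5 1"] *[rule_format, of "axis 6 1"]
      *[rule_format, of "axis 7 1"] *[rule_format, of "axis 8 1"] assms
    by (auto simp: metric_ii_def odot_def tens_def axis_def)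
  then show "x = 0"
    by (intro vec8_eqI) simp_all
qed (rule bilinear_metric_ii)

text \<open>The symmetric part in Koszul's formula pairs with z through g([z,x],y) + g([z,y],x). It
  has no components 7 and 8 because those directions are central and the metric pairs them only with
  each other. The constants are 7/6 = (7/3)/2, 49/15 = (98/15)/2 and 7/5 = (49/15)/(7/3); dividing
  by the sign \<open>s\<close> is the same as multiplying by it.\<close>

definition conn_ii :: "real \<Rightarrow> real ^ 8 \<Rightarrow> real ^ 8 \<Rightarrow> real ^ 8" where
  "conn_ii s x y = (1/2) *\<^sub>R n8 x y + vector [
     - 7/6 * odot 1 5 x y - 7/6 * s * odot 3 6 x y - 49/15 * s * odot 4 8 x y
         + 49/15 * s * odot 6 7 x y,
     7/6 * odot 2 5 x y - 49/15 * s * odot 3 7 x y + 7/6 * s * odot 4 6 x y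
         + 49/15 * s * odot 6 8 x y,
     - 7/6 * odot 1 6 x y + 49/15 * odot 2 8 x y - 7/6 * s * odot 3 5 x y + 49/15 * odot 5 7 x y,
     49/15 * odot 1 7 x y + 7/6 * odot 2 6 x y + 7/6 * s * odot 4 5 x y + 49/15 * odot 5 8 x y,
     7/5 * s * odot 3 8 x y + 7/5 * s * odot 4 7 x y,
     7/5 * odot 1 8 x y + 7/5 * odot 2 7 x y,
     0,
     0]"

lemma conn_ii_nth:
  "conn_ii s x y $ 1 = 1/2 * n8 x y $ 1 + (- 7/6 * odot 1 5 x y - 7/6 * s * odot 3 6 x y
      - 49/15 * s * odot 4 8 x y + 49/15 * s * odot 6 7 x y)"
  "conn_ii s x y $ 2 = 1/2 * n8 x y $ 2 + (7/6 * odot 2 5 x y - 49/15 * s * odot 3 7 x y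
      + 7/6 * s * odot 4 6 x y + 49/15 * s * odot 6 8 x y)"
  "conn_ii s x y $ 3 = 1/2 * n8 x y $ 3 + (- 7/6 * odot 1 6 x y + 49/15 * odot 2 8 x y
      - 7/6 * s * odot 3 5 x y + 49/15 * odot 5 7 x y)"
  "conn_ii s x y $ 4 = 1/2 * n8 x y $ 4 + (49/15 * odot 1 7 x y + 7/6 * odot 2 6 x y
      + 7/6 * s * odot 4 5 x y + 49/15 * odot 5 8 x y)"
  "conn_ii s x y $ 5 = 1/2 * n8 x y $ 5 + (7/5 * s * odot 3 8 x y + 7/5 * s * odot 4 7 x y)"
  "conn_ii s x y $ 6 = 1/2 * n8 x y $ 6 + (7/5 * odot 1 8 x y + 7/5 * odot 2 7 x y)"
  "conn_ii s x y $ 7 = 1/2 * n8 x y $ 7"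
  "conn_ii s x y $ 8 = 1/2 * n8 x y $ 8"
  by (simp_all add: conn_ii_def vector_def)

lemma bilinear_conn_ii: "bilinear (conn_ii s)"
  unfolding bilinear_def
  by (auto intro!: linearI vec8_eqI simp: conn_ii_nth n8_nth wedge_def odot_def tens_def
      algebra_simps add_divide_distrib diff_divide_distrib)

lemma conn_ii_torsion: "conn_ii s x y - conn_ii s y x = n8 x y"
  by (rule vec8_eqI) (simp_all add: conn_ii_nth n8_nth wedge_def odot_def tens_def
      algebra_simps add_divide_distrib diff_divide_distrib)

lemma conn_ii_metric:
  assumes "s \<in> {1, -1}"
  shows "metric_ii s (conn_ii s x y) z + metric_ii s y (conn_ii s x z) = 0"
proof -
  have "s = 1 \<or> s = -1" using assms by auto
  then show ?thesis
    by (elim disjE; simp add: metric_ii_def conn_ii_nth n8_nth wedge_def odot_def tens_def;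
        simp add: algebra_simps add_divide_distrib diff_divide_distrib)
qed

lemma levi_civita_ii: "s \<in> {1, -1} \<Longrightarrow> levi_civita n8 (metric_ii s) = conn_ii s"
  by (intro levi_civita_eqI pseudo_metric_ii bilinear_conn_ii conn_ii_torsion conn_ii_metric)

section \<open>Curvature of the four metrics\<close>

lemma vector8_nth:
  "vector [a1, a2, a3, a4, a5, a6, a7, a8 :: real] $ (1::8) = a1"
  "vector [a1, a2, a3, a4, a5, a6, a7, a8 :: real] $ (2::8) = a2"
  "vector [a1, a2, a3, a4, a5, a6, a7, a8 :: real] $ (3::8) = a3"
  "vector [a1, a2, a3, a4, a5, a6, a7, a8 :: real] $ (4::8) = a4"
  "vector [a1, a2, a3, a4, a5, a6, a7, a8 :: real] $ (5::8) = a5"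
  "vector [a1, a2, a3, a4, a5, a6, a7, a8 :: real] $ (6::8) = a6"
  "vector [a1, a2, a3, a4, a5, a6, a7, a8 :: real] $ (7::8) = a7"
  "vector [a1, a2, a3, a4, a5, a6, a7, a8 :: real] $ (8::8) = a8"
  by (simp_all add: vector_def)

lemma n8_axis:
  "n8 (axis 1 1) (axis 2 1) = - axis 5 1"
  "n8 (axis 1 1) (axis 3 1) = axis 8 1"
  "n8 (axis 1 1) (axis 4 1) = - axis 6 1"
  "n8 (axis 1 1) (axis 5 1) = 0"
  "n8 (axis 1 1) (axis 6 1) = - axis 7 1"
  "n8 (axis 1 1) (axis 7 1) = 0"
  "n8 (axis 1 1) (axis 8 1) = 0"
  "n8 (axis 2 1) (axis 3 1) = axis 6 1"
  "n8 (axis 2 1) (axis 4 1) = axis 7 1"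
  "n8 (axis 2 1) (axis 5 1) = 0"
  "n8 (axis 2 1) (axis 6 1) = - axis 8 1"
  "n8 (axis 2 1) (axis 7 1) = 0"
  "n8 (axis 2 1) (axis 8 1) = 0"
  "n8 (axis 3 1) (axis 4 1) = - axis 5 1"
  "n8 (axis 3 1) (axis 5 1) = - axis 7 1"
  "n8 (axis 3 1) (axis 6 1) = 0"
  "n8 (axis 3 1) (axis 7 1) = 0"
  "n8 (axis 3 1) (axis 8 1) = 0"
  "n8 (axis 4 1) (axis 5 1) = - axis 8 1"
  "n8 (axis 4 1) (axis 6 1) = 0"
  "n8 (axis 4 1) (axis 7 1) = 0"
  "n8 (axis 4 1) (axis 8 1) = 0"
  "n8 (axis 5 1) (axis 6 1) = 0"
  "n8 (axis 5 1) (axis 7 1) = 0"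
  "n8 (axis 5 1) (axis 8 1) = 0"
  "n8 (axis 6 1) (axis 7 1) = 0"
  "n8 (axis 6 1) (axis 8 1) = 0"
  "n8 (axis 7 1) (axis 8 1) = 0"
  by (rule vec8_eqI; simp add: n8_nth wedge_def axis_def)+

lemma conn_i_axis:
  "conn_i s (axis 1 1) z = vector [0, - 7/6 * z $ 5, - 49/15 * z $ 8, - 7/6 * z $ 6,
      - 1/2 * z $ 2, - 1/2 * z $ 4 - 7/5 * z $ 7, - 1/2 * z $ 6, 1/2 * z $ 3]"
  "conn_i s (axis 2 1) z = vector [7/6 * z $ 5, 0, 7/6 * z $ 6, - 49/15 * z $ 7, 1/2 * z $ 1,
      1/2 * z $ 3 - 7/5 * z $ 8, 1/2 * z $ 4, - 1/2 * z $ 6]"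
  "conn_i s (axis 3 1) z = vector [49/15 * s * z $ 8, - 7/6 * s * z $ 6, 0, - 7/6 * s * z $ 5,
      - 1/2 * z $ 4 - 7/5 * s * z $ 7, - 1/2 * z $ 2, - 1/2 * z $ 5, - 1/2 * z $ 1]"
  "conn_i s (axis 4 1) z = vector [7/6 * s * z $ 6, 49/15 * s * z $ 7, 7/6 * s * z $ 5, 0,
      1/2 * z $ 3 - 7/5 * s * z $ 8, 1/2 * z $ 1, - 1/2 * z $ 2, - 1/2 * z $ 5]"
  "conn_i s (axis 5 1) z = vector [7/6 * z $ 2, - 7/6 * z $ 1, 7/6 * s * z $ 4 - 49/15 * z $ 7,
      - 7/6 * s * z $ 3 - 49/15 * z $ 8, 0, 0, 1/2 * z $ 3, 1/2 * z $ 4]"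
  "conn_i s (axis 6 1) z = vector [7/6 * s * z $ 4 - 49/15 * s * z $ 7, - 7/6 * s * z $ 3
      - 49/15 * s * z $ 8, 7/6 * z $ 2, - 7/6 * z $ 1, 0, 0, 1/2 * z $ 1, 1/2 * z $ 2]"
  "conn_i s (axis 7 1) z = vector [- 49/15 * s * z $ 6, 49/15 * s * z $ 4, - 49/15 * z $ 5,
      - 49/15 * z $ 2, - 7/5 * s * z $ 3, - 7/5 * z $ 1, 0, 0]"
  "conn_i s (axis 8 1) z = vector [49/15 * s * z $ 3, - 49/15 * s * z $ 6, - 49/15 * z $ 1,
      - 49/15 * z $ 5, - 7/5 * s * z $ 4, - 7/5 * z $ 2, 0, 0]"
  by (rule vec8_eqI; simp add: conn_i_nth n8_nth wedge_def odot_def tens_def axis_def vector8_nth)+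

text \<open>These are the 28 rows of the curvature operator on bivectors: lowering the curvature
  endomorphism of each pair of basis vectors gives a 2-form. Pairing it with an unknown bivector
  then reads off one linear equation.\<close>

lemma curvature_i:
  assumes "s \<in> {1, -1}"
  shows
    "metric_i s w (curvature n8 (metric_i s) (axis 1 1) (axis 2 1) z) =
       7/4 * wedge 1 2 w z + (7/6 + 7/12 * s) * wedge 3 4 w z + 49/30 * s * wedge 3 6 w z
           - 49/30 * s * wedge 3 7 w z - 49/30 * s * wedge 4 6 w z - 49/30 * s * wedge 4 8 w z
           - 343/90 * s * wedge 6 7 w z - 343/90 * s * wedge 6 8 w z + 343/75 * s * wedge 7 8 w z"
    "metric_i s w (curvature n8 (metric_i s) (axis 1 1) (axis 3 1) z) =
       - 49/10 * s * wedge 1 3 w z + (7/12 - 7/12 * s) * wedge 2 4 w z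
           + 49/15 * s * wedge 2 6 w z + 49/15 * s * wedge 4 5 w z + (49/36
           + 49/180 * s) * wedge 5 6 w z"
    "metric_i s w (curvature n8 (metric_i s) (axis 1 1) (axis 4 1) z) =
       7/4 * s * wedge 1 4 w z - 49/30 * s * wedge 1 7 w z + (-7/12 - 7/6 * s) * wedge 2 3 w z
           + 49/30 * s * wedge 2 6 w z - 49/30 * s * wedge 2 8 w z + 49/30 * s * wedge 3 5 w z
           + 343/90 * s * wedge 5 7 w z - 343/90 * wedge 5 8 w z"
    "metric_i s w (curvature n8 (metric_i s) (axis 1 1) (axis 5 1) z) =
       49/36 * wedge 1 5 w z - 49/30 * s * wedge 3 4 w z + (49/36 - 49/30 * s) * wedge 3 6 w z
           - 343/90 * wedge 4 8 w z - 343/90 * s * wedge 6 8 w z + 2401/225 * s * wedge 7 8 w z"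
    "metric_i s w (curvature n8 (metric_i s) (axis 1 1) (axis 6 1) z) =
       - 637/180 * s * wedge 1 6 w z + 49/30 * s * wedge 2 3 w z + 49/15 * s * wedge 2 4 w z
           - 343/90 * s * wedge 2 8 w z - 343/180 * s * wedge 3 5 w z
           - 343/90 * s * wedge 5 8 w z"
    "metric_i s w (curvature n8 (metric_i s) (axis 1 1) (axis 7 1) z) =
       - 49/30 * s * wedge 1 4 w z - 343/75 * s * wedge 1 7 w z + 49/30 * s * wedge 2 3 w z
           + 343/90 * s * wedge 2 6 w z - 343/90 * s * wedge 4 5 w z
           + 2401/225 * s * wedge 5 8 w z"
    "metric_i s w (curvature n8 (metric_i s) (axis 1 1) (axis 8 1) z) =
       2401/225 * s * wedge 1 8 w z - 343/75 * s * wedge 2 7 w z"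
    "metric_i s w (curvature n8 (metric_i s) (axis 2 1) (axis 3 1) z) =
       (-7/12 - 7/6 * s) * wedge 1 4 w z + 49/30 * s * wedge 1 6 w z + 49/30 * s * wedge 1 7 w z
           + 7/4 * s * wedge 2 3 w z + 49/30 * s * wedge 2 8 w z + 49/30 * s * wedge 4 5 w z
           + 343/90 * wedge 5 7 w z - 343/90 * s * wedge 5 8 w z"
    "metric_i s w (curvature n8 (metric_i s) (axis 2 1) (axis 4 1) z) =
       (7/12 - 7/12 * s) * wedge 1 3 w z + 49/15 * s * wedge 1 6 w z - 49/10 * s * wedge 2 4 w z
           + 49/15 * s * wedge 3 5 w z + (49/36 + 49/180 * s) * wedge 5 6 w z"
    "metric_i s w (curvature n8 (metric_i s) (axis 2 1) (axis 5 1) z) =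
       49/36 * wedge 2 5 w z + 49/30 * s * wedge 3 4 w z + 343/90 * wedge 3 7 w z + (49/36
           - 49/30 * s) * wedge 4 6 w z + 343/90 * s * wedge 6 7 w z
           - 2401/225 * s * wedge 7 8 w z"
    "metric_i s w (curvature n8 (metric_i s) (axis 2 1) (axis 6 1) z) =
       49/15 * s * wedge 1 3 w z + 49/30 * s * wedge 1 4 w z + 343/90 * s * wedge 1 7 w z
           - 637/180 * s * wedge 2 6 w z - 343/180 * s * wedge 4 5 w z
           + 343/90 * s * wedge 5 7 w z"
    "metric_i s w (curvature n8 (metric_i s) (axis 2 1) (axis 7 1) z) =
       - 343/75 * s * wedge 1 8 w z + 2401/225 * s * wedge 2 7 w z"
    "metric_i s w (curvature n8 (metric_i s) (axis 2 1) (axis 8 1) z) =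
       - 49/30 * s * wedge 1 4 w z - 343/90 * s * wedge 1 6 w z + 49/30 * s * wedge 2 3 w z
           - 343/75 * s * wedge 2 8 w z + 343/90 * s * wedge 3 5 w z
           + 2401/225 * s * wedge 5 7 w z"
    "metric_i s w (curvature n8 (metric_i s) (axis 3 1) (axis 4 1) z) =
       (7/6 + 7/12 * s) * wedge 1 2 w z - 49/30 * s * wedge 1 5 w z + 49/30 * s * wedge 2 5 w z
           + 7/4 * wedge 3 4 w z - 49/30 * s * wedge 3 7 w z - 49/30 * s * wedge 4 8 w z
           + 343/90 * wedge 6 7 w z + 343/90 * wedge 6 8 w z + 343/75 * wedge 7 8 w z"
    "metric_i s w (curvature n8 (metric_i s) (axis 3 1) (axis 5 1) z) =
       49/30 * s * wedge 1 4 w z - 343/180 * s * wedge 1 6 w z + 49/15 * s * wedge 2 4 w z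
           + 343/90 * s * wedge 2 8 w z - 637/180 * s * wedge 3 5 w z - 343/90 * wedge 5 8 w z"
    "metric_i s w (curvature n8 (metric_i s) (axis 3 1) (axis 6 1) z) =
       49/30 * s * wedge 1 2 w z + (49/36 - 49/30 * s) * wedge 1 5 w z + 49/36 * wedge 3 6 w z
           + 343/90 * wedge 4 8 w z - 343/90 * wedge 6 8 w z - 2401/225 * wedge 7 8 w z"
    "metric_i s w (curvature n8 (metric_i s) (axis 3 1) (axis 7 1) z) =
       - 49/30 * s * wedge 1 2 w z + 343/90 * wedge 2 5 w z - 49/30 * s * wedge 3 4 w z
           - 343/75 * wedge 3 7 w z - 343/90 * wedge 4 6 w z - 2401/225 * wedge 6 8 w z"
    "metric_i s w (curvature n8 (metric_i s) (axis 3 1) (axis 8 1) z) =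
       2401/225 * wedge 3 8 w z - 343/75 * wedge 4 7 w z"
    "metric_i s w (curvature n8 (metric_i s) (axis 4 1) (axis 5 1) z) =
       49/15 * s * wedge 1 3 w z - 343/90 * s * wedge 1 7 w z + 49/30 * s * wedge 2 3 w z
           - 343/180 * s * wedge 2 6 w z - 637/180 * s * wedge 4 5 w z + 343/90 * wedge 5 7 w z"
    "metric_i s w (curvature n8 (metric_i s) (axis 4 1) (axis 6 1) z) =
       - 49/30 * s * wedge 1 2 w z + (49/36 - 49/30 * s) * wedge 2 5 w z - 343/90 * wedge 3 7 w z
           + 49/36 * wedge 4 6 w z + 343/90 * wedge 6 7 w z + 2401/225 * wedge 7 8 w z"
    "metric_i s w (curvature n8 (metric_i s) (axis 4 1) (axis 7 1) z) =
       - 343/75 * wedge 3 8 w z + 2401/225 * wedge 4 7 w z"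
    "metric_i s w (curvature n8 (metric_i s) (axis 4 1) (axis 8 1) z) =
       - 49/30 * s * wedge 1 2 w z - 343/90 * wedge 1 5 w z - 49/30 * s * wedge 3 4 w z
           + 343/90 * wedge 3 6 w z - 343/75 * wedge 4 8 w z - 2401/225 * wedge 6 7 w z"
    "metric_i s w (curvature n8 (metric_i s) (axis 5 1) (axis 6 1) z) =
       (49/36 + 49/180 * s) * wedge 1 3 w z + (49/36 + 49/180 * s) * wedge 2 4 w z"
    "metric_i s w (curvature n8 (metric_i s) (axis 5 1) (axis 7 1) z) =
       343/90 * s * wedge 1 4 w z + 343/90 * wedge 2 3 w z + 343/90 * s * wedge 2 6 w z
           + 2401/225 * s * wedge 2 8 w z + 343/90 * wedge 4 5 w z + 2401/225 * s * wedge 5 7 w z"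
    "metric_i s w (curvature n8 (metric_i s) (axis 5 1) (axis 8 1) z) =
       - 343/90 * wedge 1 4 w z - 343/90 * s * wedge 1 6 w z + 2401/225 * s * wedge 1 7 w z
           - 343/90 * s * wedge 2 3 w z - 343/90 * wedge 3 5 w z + 2401/225 * s * wedge 5 8 w z"
    "metric_i s w (curvature n8 (metric_i s) (axis 6 1) (axis 7 1) z) =
       - 343/90 * s * wedge 1 2 w z + 343/90 * s * wedge 2 5 w z + 343/90 * wedge 3 4 w z
           + 343/90 * wedge 4 6 w z - 2401/225 * wedge 4 8 w z + 2401/225 * wedge 6 7 w z"
    "metric_i s w (curvature n8 (metric_i s) (axis 6 1) (axis 8 1) z) =
       - 343/90 * s * wedge 1 2 w z - 343/90 * s * wedge 1 5 w z + 343/90 * wedge 3 4 w z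
           - 343/90 * wedge 3 6 w z - 2401/225 * wedge 3 7 w z + 2401/225 * wedge 6 8 w z"
    "metric_i s w (curvature n8 (metric_i s) (axis 7 1) (axis 8 1) z) =
       343/75 * s * wedge 1 2 w z + 2401/225 * s * wedge 1 5 w z - 2401/225 * s * wedge 2 5 w z
           + 343/75 * wedge 3 4 w z - 2401/225 * wedge 3 6 w z + 2401/225 * wedge 4 6 w z"
  using assms unfolding curvature_def Let_def levi_civita_i[OF assms] n8_axis
  by (auto simp: bilinear_lneg[OF bilinear_conn_i] bilinear_lzero[OF bilinear_conn_i] conn_i_axis
      vector8_nth
      metric_i_def tens_def wedge_def algebra_simps add_divide_distrib diff_divide_distrib)

lemma conn_ii_axis:
  "conn_ii s (axis 1 1) z = vector [- 7/6 * z $ 5, 0, - 7/6 * z $ 6, 49/15 * z $ 7,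
      - 1/2 * z $ 2, - 1/2 * z $ 4 + 7/5 * z $ 8, - 1/2 * z $ 6, 1/2 * z $ 3]"
  "conn_ii s (axis 2 1) z = vector [0, 7/6 * z $ 5, 49/15 * z $ 8, 7/6 * z $ 6, 1/2 * z $ 1,
      1/2 * z $ 3 + 7/5 * z $ 7, 1/2 * z $ 4, - 1/2 * z $ 6]"
  "conn_ii s (axis 3 1) z = vector [- 7/6 * s * z $ 6, - 49/15 * s * z $ 7, - 7/6 * s * z $ 5, 0,
      - 1/2 * z $ 4 + 7/5 * s * z $ 8, - 1/2 * z $ 2, - 1/2 * z $ 5, - 1/2 * z $ 1]"
  "conn_ii s (axis 4 1) z = vector [- 49/15 * s * z $ 8, 7/6 * s * z $ 6, 0, 7/6 * s * z $ 5,
      1/2 * z $ 3 + 7/5 * s * z $ 7, 1/2 * z $ 1, - 1/2 * z $ 2, - 1/2 * z $ 5]"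
  "conn_ii s (axis 5 1) z = vector [- 7/6 * z $ 1, 7/6 * z $ 2, - 7/6 * s * z $ 3
      + 49/15 * z $ 7, 7/6 * s * z $ 4 + 49/15 * z $ 8, 0, 0, 1/2 * z $ 3, 1/2 * z $ 4]"
  "conn_ii s (axis 6 1) z = vector [- 7/6 * s * z $ 3 + 49/15 * s * z $ 7, 7/6 * s * z $ 4
      + 49/15 * s * z $ 8, - 7/6 * z $ 1, 7/6 * z $ 2, 0, 0, 1/2 * z $ 1, 1/2 * z $ 2]"
  "conn_ii s (axis 7 1) z = vector [49/15 * s * z $ 6, - 49/15 * s * z $ 3, 49/15 * z $ 5,
      49/15 * z $ 1, 7/5 * s * z $ 4, 7/5 * z $ 2, 0, 0]"
  "conn_ii s (axis 8 1) z = vector [- 49/15 * s * z $ 4, 49/15 * s * z $ 6, 49/15 * z $ 2,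
      49/15 * z $ 5, 7/5 * s * z $ 3, 7/5 * z $ 1, 0, 0]"
  by (rule vec8_eqI; simp add: conn_ii_nth n8_nth wedge_def odot_def tens_def axis_def vector8_nth)+

lemma curvature_ii:
  assumes "s \<in> {1, -1}"
  shows
    "metric_ii s w (curvature n8 (metric_ii s) (axis 1 1) (axis 2 1) z) =
       - 7/4 * wedge 1 2 w z + (-7/6 - 133/60 * s) * wedge 3 4 w z - 49/30 * s * wedge 3 8 w z
           - 49/30 * s * wedge 4 7 w z + 686/45 * s * wedge 7 8 w z"
    "metric_ii s w (curvature n8 (metric_ii s) (axis 1 1) (axis 3 1) z) =
       49/10 * s * wedge 1 6 w z + (-7/12 - 161/60 * s) * wedge 2 4 w z
           + 49/10 * s * wedge 3 5 w z + (343/90 + 343/90 * s) * wedge 5 7 w z"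
    "metric_ii s w (curvature n8 (metric_ii s) (axis 1 1) (axis 4 1) z) =
       - 7/4 * s * wedge 1 4 w z - 49/30 * s * wedge 1 8 w z + (7/12 - 7/15 * s) * wedge 2 3 w z
           - 49/30 * s * wedge 2 7 w z + (49/36 + 49/180 * s) * wedge 5 6 w z"
    "metric_ii s w (curvature n8 (metric_ii s) (axis 1 1) (axis 5 1) z) =
       49/36 * wedge 2 5 w z + 343/90 * wedge 3 7 w z + (49/36 - 49/30 * s) * wedge 4 6 w z
           - 343/90 * s * wedge 6 8 w z"
    "metric_ii s w (curvature n8 (metric_ii s) (axis 1 1) (axis 6 1) z) =
       49/10 * s * wedge 1 3 w z + 343/90 * s * wedge 1 7 w z - 637/180 * s * wedge 2 6 w z
           - 343/180 * s * wedge 4 5 w z - 343/90 * s * wedge 5 8 w z"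
    "metric_ii s w (curvature n8 (metric_ii s) (axis 1 1) (axis 7 1) z) =
       343/90 * s * wedge 1 6 w z + 343/75 * s * wedge 2 8 w z - 343/90 * s * wedge 3 5 w z
           - 2401/225 * s * wedge 5 7 w z"
    "metric_ii s w (curvature n8 (metric_ii s) (axis 1 1) (axis 8 1) z) =
       - 49/30 * s * wedge 1 4 w z + 343/75 * s * wedge 1 8 w z + 49/30 * s * wedge 2 3 w z
           - 2401/225 * s * wedge 2 7 w z"
    "metric_ii s w (curvature n8 (metric_ii s) (axis 2 1) (axis 3 1) z) =
       (7/12 - 7/15 * s) * wedge 1 4 w z + 49/30 * s * wedge 1 8 w z - 7/4 * s * wedge 2 3 w z
           + 49/30 * s * wedge 2 7 w z + (49/36 + 49/180 * s) * wedge 5 6 w z"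
    "metric_ii s w (curvature n8 (metric_ii s) (axis 2 1) (axis 4 1) z) =
       (-7/12 - 161/60 * s) * wedge 1 3 w z + 49/10 * s * wedge 2 6 w z
           + 49/10 * s * wedge 4 5 w z + (-343/90 - 343/90 * s) * wedge 5 8 w z"
    "metric_ii s w (curvature n8 (metric_ii s) (axis 2 1) (axis 5 1) z) =
       49/36 * wedge 1 5 w z + (49/36 - 49/30 * s) * wedge 3 6 w z - 343/90 * wedge 4 8 w z
           + 343/90 * s * wedge 6 7 w z"
    "metric_ii s w (curvature n8 (metric_ii s) (axis 2 1) (axis 6 1) z) =
       - 637/180 * s * wedge 1 6 w z + 49/10 * s * wedge 2 4 w z - 343/90 * s * wedge 2 8 w z
           - 343/180 * s * wedge 3 5 w z + 343/90 * s * wedge 5 7 w z"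
    "metric_ii s w (curvature n8 (metric_ii s) (axis 2 1) (axis 7 1) z) =
       - 49/30 * s * wedge 1 4 w z - 2401/225 * s * wedge 1 8 w z + 49/30 * s * wedge 2 3 w z
           + 343/75 * s * wedge 2 7 w z"
    "metric_ii s w (curvature n8 (metric_ii s) (axis 2 1) (axis 8 1) z) =
       343/75 * s * wedge 1 7 w z - 343/90 * s * wedge 2 6 w z + 343/90 * s * wedge 4 5 w z
           - 2401/225 * s * wedge 5 8 w z"
    "metric_ii s w (curvature n8 (metric_ii s) (axis 3 1) (axis 4 1) z) =
       (-7/6 - 133/60 * s) * wedge 1 2 w z - 7/4 * wedge 3 4 w z - 49/30 * s * wedge 3 8 w z
           - 49/30 * s * wedge 4 7 w z + 686/45 * wedge 7 8 w z"
    "metric_ii s w (curvature n8 (metric_ii s) (axis 3 1) (axis 5 1) z) =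
       49/10 * s * wedge 1 3 w z - 343/90 * s * wedge 1 7 w z - 343/180 * s * wedge 2 6 w z
           - 637/180 * s * wedge 4 5 w z - 343/90 * wedge 5 8 w z"
    "metric_ii s w (curvature n8 (metric_ii s) (axis 3 1) (axis 6 1) z) =
       (49/36 - 49/30 * s) * wedge 2 5 w z - 343/90 * wedge 3 7 w z + 49/36 * wedge 4 6 w z
           - 343/90 * wedge 6 8 w z"
    "metric_ii s w (curvature n8 (metric_ii s) (axis 3 1) (axis 7 1) z) =
       343/90 * wedge 1 5 w z - 343/90 * wedge 3 6 w z + 343/75 * wedge 4 8 w z
           + 2401/225 * wedge 6 7 w z"
    "metric_ii s w (curvature n8 (metric_ii s) (axis 3 1) (axis 8 1) z) =
       - 49/30 * s * wedge 1 2 w z - 49/30 * s * wedge 3 4 w z + 343/75 * wedge 3 8 w z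
           - 2401/225 * wedge 4 7 w z"
    "metric_ii s w (curvature n8 (metric_ii s) (axis 4 1) (axis 5 1) z) =
       - 343/180 * s * wedge 1 6 w z + 49/10 * s * wedge 2 4 w z + 343/90 * s * wedge 2 8 w z
           - 637/180 * s * wedge 3 5 w z + 343/90 * wedge 5 7 w z"
    "metric_ii s w (curvature n8 (metric_ii s) (axis 4 1) (axis 6 1) z) =
       (49/36 - 49/30 * s) * wedge 1 5 w z + 49/36 * wedge 3 6 w z + 343/90 * wedge 4 8 w z
           + 343/90 * wedge 6 7 w z"
    "metric_ii s w (curvature n8 (metric_ii s) (axis 4 1) (axis 7 1) z) =
       - 49/30 * s * wedge 1 2 w z - 49/30 * s * wedge 3 4 w z - 2401/225 * wedge 3 8 w z
           + 343/75 * wedge 4 7 w z"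
    "metric_ii s w (curvature n8 (metric_ii s) (axis 4 1) (axis 8 1) z) =
       - 343/90 * wedge 2 5 w z + 343/75 * wedge 3 7 w z + 343/90 * wedge 4 6 w z
           + 2401/225 * wedge 6 8 w z"
    "metric_ii s w (curvature n8 (metric_ii s) (axis 5 1) (axis 6 1) z) =
       (49/36 + 49/180 * s) * wedge 1 4 w z + (49/36 + 49/180 * s) * wedge 2 3 w z"
    "metric_ii s w (curvature n8 (metric_ii s) (axis 5 1) (axis 7 1) z) =
       (343/90 + 343/90 * s) * wedge 1 3 w z - 2401/225 * s * wedge 1 7 w z
           + 343/90 * s * wedge 2 6 w z + 343/90 * wedge 4 5 w z - 2401/225 * s * wedge 5 8 w z"
    "metric_ii s w (curvature n8 (metric_ii s) (axis 5 1) (axis 8 1) z) =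
       - 343/90 * s * wedge 1 6 w z + (-343/90 - 343/90 * s) * wedge 2 4 w z
           - 2401/225 * s * wedge 2 8 w z - 343/90 * wedge 3 5 w z - 2401/225 * s * wedge 5 7 w z"
    "metric_ii s w (curvature n8 (metric_ii s) (axis 6 1) (axis 7 1) z) =
       343/90 * s * wedge 2 5 w z + 2401/225 * wedge 3 7 w z + 343/90 * wedge 4 6 w z
           - 2401/225 * wedge 6 8 w z"
    "metric_ii s w (curvature n8 (metric_ii s) (axis 6 1) (axis 8 1) z) =
       - 343/90 * s * wedge 1 5 w z - 343/90 * wedge 3 6 w z + 2401/225 * wedge 4 8 w z
           - 2401/225 * wedge 6 7 w z"
    "metric_ii s w (curvature n8 (metric_ii s) (axis 7 1) (axis 8 1) z) =
       686/45 * s * wedge 1 2 w z + 686/45 * wedge 3 4 w z"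
  using assms unfolding curvature_def Let_def levi_civita_ii[OF assms] n8_axis
  by (auto simp: bilinear_lneg[OF bilinear_conn_ii] bilinear_lzero[OF bilinear_conn_ii]
      conn_ii_axis vector8_nth
      metric_ii_def odot_def tens_def wedge_def algebra_simps add_divide_distrib
          diff_divide_distrib)

lemma sum_8: "sum f (UNIV :: 8 set) = f 1 + f 2 + f 3 + f 4 + f 5 + f 6 + f 7 + f 8"
  for f :: "8 \<Rightarrow> 'a::comm_monoid_add"
proof -
  have UNIV: "(UNIV :: 8 set) = {1, 2, 3, 4, 5, 6, 7, 8}"
    using ex8 by blast
  show ?thesis
    unfolding UNIV by (simp add: add.assoc)
qed

text \<open>The Einstein constant 7/15 is one eighth of the scalar curvature 56/15.\<close>

lemma ricci_tensor_i:
  assumes "s \<in> {1, -1}"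
  shows "ricci_tensor n8 (metric_i s) y z = 7/15 * metric_i s y z"
proof -
  have "s = 1 \<or> s = -1" using assms by auto
  then show ?thesis
    unfolding ricci_tensor_def trace_def matrix_def curvature_def Let_def levi_civita_i[OF assms]
        sum_8
    by (elim disjE; simp add: conn_i_axis conn_i_nth n8_nth wedge_def odot_def tens_def
        vector8_nth axis_def metric_i_def;
        simp add: algebra_simps add_divide_distrib diff_divide_distrib)
qed

lemma not_locally_symmetric_i:
  assumes "s \<in> {1, -1}"
  shows "\<not> locally_symmetric n8 (metric_i s)"
proof -
  \<comment> \<open>Only one term survives: the connection along e5 kills e5 and e6, and the
    curvature of (e5, e6) kills e7. But the connection along e5 sends e7 to a nonzero multiple of
    e3, which the curvature of (e5, e6) maps to a nonzero multiple of e1.\<close>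
  have "nabla_curvature n8 (metric_i s) (axis 5 1) (axis 5 1) (axis 6 1) (axis 7 1) $ 1 \<noteq> 0"
    unfolding nabla_curvature_def curvature_def Let_def levi_civita_i[OF assms] n8_axis
    using assms
    by (auto simp: conn_i_axis conn_i_nth n8_nth wedge_def odot_def tens_def vector8_nth axis_def)
  then show ?thesis
    unfolding locally_symmetric_def by (metis zero_index)
qed

text \<open>The curvature operator splits into blocks of sizes 13, 11, 2 and 2. In each block the
  index pairs of the equations are the index pairs of the unknowns, so the systems are solved
  separately.\<close>

lemma curvature_i_nondegenerate:
  assumes s: "s \<in> {1, -1}" and anti: "\<And>i j. h j i = - h i j"
    and h: "\<And>x y. pairing h (\<lambda>w z. metric_i s w (curvature n8 (metric_i s) x y z)) = 0"
  shows "h = (\<lambda>_ _. 0)"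
proof -
  have "s = 1 \<or> s = -1" using s by auto
  note sign = disjE[OF this]
  \<comment> \<open>Antisymmetry leaves one unknown for each unordered index pair. With the sign
    fixed to 1 or -1, the equations become linear with rational coefficients.\<close>
  have pairing_wedge: "pairing h (wedge k l) = 2 * h k l" for k l
    using anti[of k l] by (simp add: pairing_wedge)
  have "h 1 3 = 0 \<and> h 1 4 = 0 \<and> h 1 6 = 0 \<and> h 1 7 = 0 \<and> h 2 3 = 0
      \<and> h 2 4 = 0 \<and> h 2 6 = 0 \<and> h 2 8 = 0 \<and> h 3 5 = 0 \<and> h 4 5 = 0
      \<and> h 5 6 = 0 \<and> h 5 7 = 0 \<and> h 5 8 = 0"
    using h[of "axis 1 1" "axis 3 1"] h[of "axis 1 1" "axis 4 1"] h[of "axis 1 1" "axis 6 1"]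
      h[of "axis 1 1" "axis 7 1"] h[of "axis 2 1" "axis 3 1"] h[of "axis 2 1" "axis 4 1"]
      h[of "axis 2 1" "axis 6 1"] h[of "axis 2 1" "axis 8 1"] h[of "axis 3 1" "axis 5 1"]
      h[of "axis 4 1" "axis 5 1"] h[of "axis 5 1" "axis 6 1"] h[of "axis 5 1" "axis 7 1"]
      h[of "axis 5 1" "axis 8 1"]
    unfolding curvature_i[OF s] pairing_simps pairing_wedge
    by - (rule sign; hypsubst?; intro conjI; algebra)
  moreover have "h 1 2 = 0 \<and> h 1 5 = 0 \<and> h 2 5 = 0 \<and> h 3 4 = 0 \<and> h 3 6 = 0
      \<and> h 3 7 = 0 \<and> h 4 6 = 0 \<and> h 4 8 = 0 \<and> h 6 7 = 0 \<and> h 6 8 = 0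
      \<and> h 7 8 = 0"
    using h[of "axis 1 1" "axis 2 1"] h[of "axis 1 1" "axis 5 1"] h[of "axis 2 1" "axis 5 1"]
      h[of "axis 3 1" "axis 4 1"] h[of "axis 3 1" "axis 6 1"] h[of "axis 3 1" "axis 7 1"]
      h[of "axis 4 1" "axis 6 1"] h[of "axis 4 1" "axis 8 1"] h[of "axis 6 1" "axis 7 1"]
      h[of "axis 6 1" "axis 8 1"] h[of "axis 7 1" "axis 8 1"]
    unfolding curvature_i[OF s] pairing_simps pairing_wedge
    by - (rule sign; hypsubst?; intro conjI; algebra)
  moreover have "h 1 8 = 0 \<and> h 2 7 = 0"
    using h[of "axis 1 1" "axis 8 1"] h[of "axis 2 1" "axis 7 1"]
    unfolding curvature_i[OF s] pairing_simps pairing_wedge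
    by - (rule sign; hypsubst?; intro conjI; algebra)
  moreover have "h 3 8 = 0 \<and> h 4 7 = 0"
    using h[of "axis 3 1" "axis 8 1"] h[of "axis 4 1" "axis 7 1"]
    unfolding curvature_i[OF s] pairing_simps pairing_wedge
    by - (rule sign; hypsubst?; intro conjI; algebra)
  ultimately
  have "h i j = 0 \<or> h j i = 0 \<or> i = j" for i j
    using ex8[of i] ex8[of j] by (elim disjE) simp_all
  moreover have "h i i = 0" for i
    using anti[of i i] by simp
  ultimately show ?thesis
    using anti by (intro ext) (metis neg_equal_0_iff_equal)
qed

lemma ricci_tensor_ii:
  assumes "s \<in> {1, -1}"
  shows "ricci_tensor n8 (metric_ii s) y z = 7/15 * metric_ii s y z"
proof -
  have "s = 1 \<or> s = -1" using assms by auto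
  then show ?thesis
    unfolding ricci_tensor_def trace_def matrix_def curvature_def Let_def levi_civita_ii[OF assms]
        sum_8
    by (elim disjE; simp add: conn_ii_axis conn_ii_nth n8_nth wedge_def odot_def tens_def
        vector8_nth axis_def metric_ii_def;
        simp add: algebra_simps add_divide_distrib diff_divide_distrib)
qed

lemma not_locally_symmetric_ii:
  assumes "s \<in> {1, -1}"
  shows "\<not> locally_symmetric n8 (metric_ii s)"
proof -
  \<comment> \<open>The same single term as for the diagonal metrics: e7 goes to a multiple of e3
    under the connection along e5, and then to a multiple of e1 under the curvature of (e5,
    e6).\<close>
  have "nabla_curvature n8 (metric_ii s) (axis 5 1) (axis 5 1) (axis 6 1) (axis 7 1) $ 1 \<noteq> 0"
    unfolding nabla_curvature_def curvature_def Let_def levi_civita_ii[OF assms] n8_axis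
    using assms
    by (auto simp: conn_ii_axis conn_ii_nth n8_nth wedge_def odot_def tens_def vector8_nth axis_def)
  then show ?thesis
    unfolding locally_symmetric_def by (metis zero_index)
qed

text \<open>Blocks of sizes 5, 5, 5, 4, 4, 5. As the metric pairs 1 with 2, 3 with 4 and 7 with 8,
  the equations of a block need not carry the index pairs of its unknowns: the first and last blocks
  exchange their index pairs, and so do the two of size 4.\<close>

lemma curvature_ii_nondegenerate:
  assumes s: "s \<in> {1, -1}" and anti: "\<And>i j. h j i = - h i j"
    and h: "\<And>x y. pairing h (\<lambda>w z. metric_ii s w (curvature n8 (metric_ii s) x y z)) = 0"
  shows "h = (\<lambda>_ _. 0)"
proof -
  have "s = 1 \<or> s = -1" using s by auto
  note sign = disjE[OF this]
  have pairing_wedge: "pairing h (wedge k l) = 2 * h k l" for k l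
    using anti[of k l] by (simp add: pairing_wedge)
  have "h 1 3 = 0 \<and> h 1 7 = 0 \<and> h 2 6 = 0 \<and> h 4 5 = 0 \<and> h 5 8 = 0"
    using h[of "axis 1 1" "axis 6 1"] h[of "axis 2 1" "axis 4 1"] h[of "axis 2 1" "axis 8 1"]
      h[of "axis 3 1" "axis 5 1"] h[of "axis 5 1" "axis 7 1"]
    unfolding curvature_ii[OF s] pairing_simps pairing_wedge
    by - (rule sign; hypsubst?; intro conjI; algebra)
  moreover have "h 1 2 = 0 \<and> h 3 4 = 0 \<and> h 3 8 = 0 \<and> h 4 7 = 0 \<and> h 7 8 = 0"
    using h[of "axis 1 1" "axis 2 1"] h[of "axis 3 1" "axis 4 1"] h[of "axis 3 1" "axis 8 1"]
      h[of "axis 4 1" "axis 7 1"] h[of "axis 7 1" "axis 8 1"]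
    unfolding curvature_ii[OF s] pairing_simps pairing_wedge
    by - (rule sign; hypsubst?; intro conjI; algebra)
  moreover have "h 1 4 = 0 \<and> h 1 8 = 0 \<and> h 2 3 = 0 \<and> h 2 7 = 0 \<and> h 5 6 = 0"
    using h[of "axis 1 1" "axis 4 1"] h[of "axis 1 1" "axis 8 1"] h[of "axis 2 1" "axis 3 1"]
      h[of "axis 2 1" "axis 7 1"] h[of "axis 5 1" "axis 6 1"]
    unfolding curvature_ii[OF s] pairing_simps pairing_wedge
    by - (rule sign; hypsubst?; intro conjI; algebra)
  moreover have "h 2 5 = 0 \<and> h 3 7 = 0 \<and> h 4 6 = 0 \<and> h 6 8 = 0"
    using h[of "axis 1 1" "axis 5 1"] h[of "axis 3 1" "axis 6 1"] h[of "axis 4 1" "axis 8 1"]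
      h[of "axis 6 1" "axis 7 1"]
    unfolding curvature_ii[OF s] pairing_simps pairing_wedge
    by - (rule sign; hypsubst?; intro conjI; algebra)
  moreover have "h 1 5 = 0 \<and> h 3 6 = 0 \<and> h 4 8 = 0 \<and> h 6 7 = 0"
    using h[of "axis 2 1" "axis 5 1"] h[of "axis 3 1" "axis 7 1"] h[of "axis 4 1" "axis 6 1"]
      h[of "axis 6 1" "axis 8 1"]
    unfolding curvature_ii[OF s] pairing_simps pairing_wedge
    by - (rule sign; hypsubst?; intro conjI; algebra)
  moreover have "h 1 6 = 0 \<and> h 2 4 = 0 \<and> h 2 8 = 0 \<and> h 3 5 = 0 \<and> h 5 7 = 0"
    using h[of "axis 1 1" "axis 3 1"] h[of "axis 1 1" "axis 7 1"] h[of "axis 2 1" "axis 6 1"]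
      h[of "axis 4 1" "axis 5 1"] h[of "axis 5 1" "axis 8 1"]
    unfolding curvature_ii[OF s] pairing_simps pairing_wedge
    by - (rule sign; hypsubst?; intro conjI; algebra)
  ultimately
  have "h i j = 0 \<or> h j i = 0 \<or> i = j" for i j
    using ex8[of i] ex8[of j] by (elim disjE) simp_all
  moreover have "h i i = 0" for i
    using anti[of i i] by simp
  ultimately show ?thesis
    using anti by (intro ext) (metis neg_equal_0_iff_equal)
qed

section \<open>Orthonormal frames\<close>

text \<open>The ranges are replaced by explicitly listed sets so that membership of a concrete index
  modulo 8 can be decided by evaluation.\<close>

lemma diag_pq_mult_nth:
  assumes "{1..p} = P" and "{p+1..p+q} = Q"
  shows "(diag_pq p q *v y) $ i =
    (if i \<in> of_nat ` P then y $ i else if i \<in> of_nat ` Q then - y $ i else 0)"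
proof -
  have "(diag_pq p q *v y) $ i = (\<Sum>j\<in>UNIV. if j = i then diag_pq p q $ i $ i * y $ i else 0)"
    unfolding matrix_vector_mult_def vec_lambda_beta
    by (intro sum.cong HOL.refl) (simp add: diag_pq_def)
  moreover have "diag_pq p q $ i $ i = (if i \<in> of_nat ` P then 1 else if i \<in> of_nat ` Q then
      - 1 else 0)"
    unfolding diag_pq_def vec_lambda_beta assms by simp
  ultimately show ?thesis
    by simp
qed

lemma inner_diag_pq:
  "x \<bullet> (diag_pq 6 2 *v y) =
    x$1 * y$1 + x$2 * y$2 + x$3 * y$3 + x$4 * y$4 + x$5 * y$5 + x$6 * y$6 - x$7 * y$7 - x$8 * y$8"
  "x \<bullet> (diag_pq 3 5 *v y) =
    x$1 * y$1 + x$2 * y$2 + x$3 * y$3 - x$4 * y$4 - x$5 * y$5 - x$6 * y$6 - x$7 * y$7 - x$8 * y$8"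
  "x \<bullet> (diag_pq 5 3 *v y) =
    x$1 * y$1 + x$2 * y$2 + x$3 * y$3 + x$4 * y$4 + x$5 * y$5 - x$6 * y$6 - x$7 * y$7 - x$8 * y$8"
  "x \<bullet> (diag_pq 4 4 *v y) =
    x$1 * y$1 + x$2 * y$2 + x$3 * y$3 + x$4 * y$4 - x$5 * y$5 - x$6 * y$6 - x$7 * y$7 - x$8 * y$8"
proof -
  have "{1..6::nat} = {1, 2, 3, 4, 5, 6}" "{6+1..6+2::nat} = {7, 8}"
    by auto
  from diag_pq_mult_nth[OF this]
  show "x \<bullet> (diag_pq 6 2 *v y) =
    x$1 * y$1 + x$2 * y$2 + x$3 * y$3 + x$4 * y$4 + x$5 * y$5 + x$6 * y$6 - x$7 * y$7 - x$8 * y$8"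
    by (simp add: inner_vec_def sum_8)
  have "{1..3::nat} = {1, 2, 3}" "{3+1..3+5::nat} = {4, 5, 6, 7, 8}"
    by auto
  from diag_pq_mult_nth[OF this]
  show "x \<bullet> (diag_pq 3 5 *v y) =
    x$1 * y$1 + x$2 * y$2 + x$3 * y$3 - x$4 * y$4 - x$5 * y$5 - x$6 * y$6 - x$7 * y$7 - x$8 * y$8"
    by (simp add: inner_vec_def sum_8)
  have "{1..5::nat} = {1, 2, 3, 4, 5}" "{5+1..5+3::nat} = {6, 7, 8}"
    by auto
  from diag_pq_mult_nth[OF this]
  show "x \<bullet> (diag_pq 5 3 *v y) =
    x$1 * y$1 + x$2 * y$2 + x$3 * y$3 + x$4 * y$4 + x$5 * y$5 - x$6 * y$6 - x$7 * y$7 - x$8 * y$8"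
    by (simp add: inner_vec_def sum_8)
  have "{1..4::nat} = {1, 2, 3, 4}" "{4+1..4+4::nat} = {5, 6, 7, 8}"
    by auto
  from diag_pq_mult_nth[OF this]
  show "x \<bullet> (diag_pq 4 4 *v y) =
    x$1 * y$1 + x$2 * y$2 + x$3 * y$3 + x$4 * y$4 - x$5 * y$5 - x$6 * y$6 - x$7 * y$7 - x$8 * y$8"
    by (simp add: inner_vec_def sum_8)
qed

lemma frame_i:
  "\<exists>f. linear f
      \<and> (\<forall>x y. metric_i 1 (f x) (f y) = x \<bullet> (diag_pq 6 2 *v y))"
  "\<exists>f. linear f
      \<and> (\<forall>x y. metric_i (-1) (f x) (f y) = x \<bullet> (diag_pq 3 5 *v y))"
proof -
  \<comment> \<open>Normalizing factors for the coefficients 7/3 and 98/15, up to sign.\<close>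
  define a b :: real where "a = sqrt (3/7)" and "b = sqrt (15/98)"
  have ab: "a * a = 3/7" "b * b = 15/98"
    by (simp_all add: a_def b_def)
  have aab: "a * (u * (a * v)) = 3/7 * (u * v)" "b * (u * (b * v)) = 15/98 * (u * v)" for u v
    by (simp_all only: mult.left_commute[of u] ab flip: mult.assoc[of a a] mult.assoc[of b b])
  \<comment> \<open>The coordinates are permuted so that positive directions come first: e1, ...,
    e4, e7, e8 for the upper signs, and e1, e2, e6 for the lower ones.\<close>
  define f f' :: "real ^ 8 \<Rightarrow> real ^ 8" where
    "f x = vector [x$1, x$2, x$3, x$4, a * x$7, a * x$8, b * x$5, b * x$6]" and
    "f' x = vector [x$1, x$2, x$4, x$5, a * x$6, a * x$3, b * x$7, b * x$8]" for x
  have "linear f" "linear f'"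
    unfolding f_def f'_def by (auto intro!: linearI vec8_eqI simp: vector8_nth algebra_simps)
  moreover have "metric_i 1 (f x) (f y) = x \<bullet> (diag_pq 6 2 *v y)" for x y
    by (simp add: inner_diag_pq metric_i_def tens_def f_def vector8_nth mult.assoc aab)
  moreover have "metric_i (-1) (f' x) (f' y) = x \<bullet> (diag_pq 3 5 *v y)" for x y
    by (simp add: inner_diag_pq metric_i_def tens_def f'_def vector8_nth mult.assoc aab; simp add:
        field_simps)
  ultimately show
    "\<exists>f. linear f
        \<and> (\<forall>x y. metric_i 1 (f x) (f y) = x \<bullet> (diag_pq 6 2 *v y))"
    "\<exists>f. linear f
        \<and> (\<forall>x y. metric_i (-1) (f x) (f y) = x \<bullet> (diag_pq 3 5 *v y))"
    by blast+
qed

lemma frame_ii: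
  "\<exists>f. linear f
      \<and> (\<forall>x y. metric_ii 1 (f x) (f y) = x \<bullet> (diag_pq 5 3 *v y))"
  "\<exists>f. linear f
      \<and> (\<forall>x y. metric_ii (-1) (f x) (f y) = x \<bullet> (diag_pq 4 4 *v y))"
proof -
  \<comment> \<open>Each of the planes (1,2), (3,4) and (7,8) is hyperbolic. Sums and differences of
    coordinates diagonalize it, producing a factor 2, so \<open>b\<close> and \<open>c\<close>
    satisfy 2 b^2 98/15 = 1 and 2 c^2 = 1.\<close>
  define a b c :: real where "a = sqrt (3/7)" and "b = sqrt (15/196)" and "c = sqrt (1/2)"
  have ab: "a * a = 3/7" "b * b = 15/196" "c * c = 1/2"
    by (simp_all add: a_def b_def c_def)
  have aab: "(a * u) * (a * v) = 3/7 * (u * v)" "(b * u) * (b * v) = 15/196 * (u * v)"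
    "(c * u) * (c * v) = 1/2 * (u * v)" for u v
    by (simp_all only: mult.assoc mult.left_commute[of u],
        simp_all only: ab flip: mult.assoc[of a a] mult.assoc[of b b] mult.assoc[of c c])
  \<comment> \<open>Each hyperbolic plane contributes one positive and one negative direction. The
    remaining e5 and e6 are both positive for the upper signs, giving (5,3), and of opposite sign
    for the lower ones, giving (4,4).\<close>
  define f f' :: "real ^ 8 \<Rightarrow> real ^ 8" where
    "f x = vector [c * (x$1 + x$6), c * (x$6 - x$1), c * (x$2 + x$7), c * (x$7 - x$2),
       a * x$3, a * x$4, b * (x$5 + x$8), b * (x$5 - x$8)]" and
    "f' x = vector [c * (x$1 + x$5), c * (x$5 - x$1), c * (x$2 + x$6), c * (x$2 - x$6),
       a * x$3, a * x$7, b * (x$4 + x$8), b * (x$8 - x$4)]" for x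
  have "linear f" "linear f'"
    unfolding f_def f'_def by (auto intro!: linearI vec8_eqI simp: vector8_nth algebra_simps)
  moreover have "metric_ii 1 (f x) (f y) = x \<bullet> (diag_pq 5 3 *v y)" for x y
    unfolding inner_diag_pq metric_ii_def odot_def tens_def f_def vector8_nth aab by algebra
  moreover have "metric_ii (-1) (f' x) (f' y) = x \<bullet> (diag_pq 4 4 *v y)" for x y
    unfolding inner_diag_pq metric_ii_def odot_def tens_def f'_def vector8_nth aab by algebra
  ultimately show
    "\<exists>f. linear f
        \<and> (\<forall>x y. metric_ii 1 (f x) (f y) = x \<bullet> (diag_pq 5 3 *v y))"
    "\<exists>f. linear f
        \<and> (\<forall>x y. metric_ii (-1) (f x) (f y) = x \<bullet> (diag_pq 4 4 *v y))"
    by blast+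
qed

section \<open>From the explicit connection to Einstein metrics with generic holonomy\<close>

lemma einstein_with_generic_holonomy:
  assumes g: "pseudo_metric g" and D: "bilinear D" "levi_civita n8 g = D"
    and compat: "\<And>x y z. g (D x y) z + g y (D x z) = 0"
    and ric: "\<And>y z. ricci_tensor n8 g y z = 7/15 * g y z"
    and nondeg: "\<And>h. (\<And>i j. h j i = - h i j) \<Longrightarrow>
      (\<And>x y. pairing h (\<lambda>w z. g w (curvature n8 g x y z)) = 0) \<Longrightarrow> h = (\<lambda>_ _. 0)"
    and pq: "p + q = 8"
    and frame: "\<exists>f. linear f
        \<and> (\<forall>x y. g (f x) (f y) = x \<bullet> (diag_pq p q *v y))"
  shows "einstein n8 g \<and> scalar_curvature n8 g = 56/15 \<and> holonomy_is_SO_plus n8 g p q"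
proof (intro conjI)
  interpret n8_connection g D
    using D by unfold_locales
  show "einstein n8 g" "scalar_curvature n8 g = 56/15"
    using einstein_scalar_curvature[OF g ric] by simp_all
  obtain f where f: "linear f" "\<And>x y. g (f x) (f y) = x \<bullet> (diag_pq p q *v y)"
    using frame by blast
  have "g (matrix f *v x) (matrix f *v y) = x \<bullet> (diag_pq p q *v y)" for x y
    using f by (simp add: matrix_works)
  moreover have "bilinear g"
    using g by (simp add: pseudo_metric_def)
  moreover have "Z \<in> tangent (holonomy_group n8 g)"
    if "\<And>x y. g (Z *v x) y + g x (Z *v y) = 0" for Z
    using skew_mem_tangent[OF g compat nondeg that] .
  ultimately show "holonomy_is_SO_plus n8 g p q"
    by (intro holonomy_is_SO_plusI[OF _ compat pq]) blast+
qed

lemma metric_i_properties: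
  assumes s: "s \<in> {1, -1}" and "p + q = 8"
    and "\<exists>f. linear f
        \<and> (\<forall>x y. metric_i s (f x) (f y) = x \<bullet> (diag_pq p q *v y))"
  shows "pseudo_metric (metric_i s) \<and> einstein n8 (metric_i s) \<and>
    scalar_curvature n8 (metric_i s) = 56/15 \<and> \<not> locally_symmetric n8 (metric_i s) \<and>
    holonomy_is_SO_plus n8 (metric_i s) p q"
proof -
  have "einstein n8 (metric_i s) \<and> scalar_curvature n8 (metric_i s) = 56/15 \<and>
      holonomy_is_SO_plus n8 (metric_i s) p q"
    by (rule einstein_with_generic_holonomy[OF pseudo_metric_i[OF s] bilinear_conn_i
        levi_civita_i[OF s]
          conn_i_metric[OF s] ricci_tensor_i[OF s] _ assms(2,3)])
      (rule curvature_i_nondegenerate[OF s])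
  with pseudo_metric_i[OF s] not_locally_symmetric_i[OF s] show ?thesis
    by blast
qed

lemma metric_ii_properties:
  assumes s: "s \<in> {1, -1}" and "p + q = 8"
    and "\<exists>f. linear f
        \<and> (\<forall>x y. metric_ii s (f x) (f y) = x \<bullet> (diag_pq p q *v y))"
  shows "pseudo_metric (metric_ii s) \<and> einstein n8 (metric_ii s) \<and>
    scalar_curvature n8 (metric_ii s) = 56/15
        \<and> \<not> locally_symmetric n8 (metric_ii s) \<and>
    holonomy_is_SO_plus n8 (metric_ii s) p q"
proof -
  have "einstein n8 (metric_ii s) \<and> scalar_curvature n8 (metric_ii s) = 56/15 \<and>
      holonomy_is_SO_plus n8 (metric_ii s) p q"
    by (rule einstein_with_generic_holonomy[OF pseudo_metric_ii[OF s] bilinear_conn_ii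
        levi_civita_ii[OF s]
          conn_ii_metric[OF s] ricci_tensor_ii[OF s] _ assms(2,3)])
      (rule curvature_ii_nondegenerate[OF s])
  with pseudo_metric_ii[OF s] not_locally_symmetric_ii[OF s] show ?thesis
    by blast
qed

theorem theorem5p2:
  shows "\<forall>(g, p, q) \<in> {(metric_i 1, 6, 2), (metric_i (-1), 3, 5),
                       (metric_ii 1, 5, 3), (metric_ii (-1), 4, 4)}.
    pseudo_metric g \<and> einstein n8 g \<and> scalar_curvature n8 g = 56/15 \<and>
    \<not> locally_symmetric n8 g \<and> holonomy_is_SO_plus n8 g p q"
  using metric_i_properties[OF _ _ frame_i(1)] metric_i_properties[OF _ _ frame_i(2)]
    metric_ii_properties[OF _ _ frame_ii(1)] metric_ii_properties[OF _ _ frame_ii(2)]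
  by simp

end
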